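(* Assume conditional exogeneity and exclusion, $\{Y(0),\dots,Y(n),S\}\perp Z\mid X$, and the rank condition that $\operatorname{Cov}(\ddot Z,\ddot D)$ has full rank. Then $$\beta^{\text{2SLS}}=E\left[w^{S,X}\beta^{S,X}\right],$$ where, for $x$ in the support of $X$ and $s\in\mathcal S_x$, $$w^{s,x}\equiv\operatorname{Var}(\ddot P)^{-1}\operatorname{Cov}\left(\ddot P,v_s(Z)\mid X=x\right),\qquad \beta^{s,x}\equiv(\beta_1^{s,x},\dots,\beta_n^{s,x})^T\equiv E[\beta\mid S=s,X=x],$$ with $v_s(Z)\equiv(s_1(Z),\dots,s_n(Z))^T$.
   Context: Setting: on a probability space there are a treatment $T\in\{0,1,\dots,n\}$, an outcome $Y\in\mathbb R$, an instrument vector $Z\in\mathcal Z\subseteq\mathbb R^m$, $m\ge n$, and a vector of controls $X$ with finite support. Response types are mappings $s:\mathcal Z\to\{0,\dots,n\}$; the random response type $S$ describes potential treatment choices, $T=S(Z)$. $Y(0),\dots,Y(n)$ are potential outcomes, $Y=Y(T)$. $\mathcal S_x$ is the set of response types $s$ with $\Pr[S=s\mid X=x]>0$. Treatment effects of interest $\beta=(\beta_1,\dots,\beta_n)^T$ ($n$ relative treatment effects, each a difference of two potential outcomes) come with treatment indicators $D=(D_1,\dots,D_n)^T$, $D_k=\mathbf 1[T\in R_k]$, $R_k\subset\{0,\dots,n\}$, chosen so that $Y=\alpha+\sum_kD_k\beta_k$ with $\alpha$ a function of $Y(0),\dots,Y(n)$; e.g. $\beta_k=Y(k)-Y(0)$,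 $D_k=\mathbf 1[T=k]$ (unordered) or $\beta_k=Y(k)-Y(k-1)$, $D_k=\mathbf 1[T\ge k]$ (ordered). For a response type $s$, $s_k(z)=\mathbf 1[s(z)\in R_k]$. $\operatorname{Cov}(A,B)=E[(A-E[A])(B-E[B])^T]$, $\operatorname{Var}(A)=\operatorname{Cov}(A,A)$. Relevant moments are finite and $\operatorname{Var}(\ddot Z)$ is invertible. Demeaned variables: $\ddot Y=Y-E[Y\mid X]$, $\ddot D=D-E[D\mid X]$, $\ddot Z=Z-E[Z\mid X]$. $\ddot P=\operatorname{Cov}(\ddot D,\ddot Z)\operatorname{Var}(\ddot Z)^{-1}\ddot Z$ is the linear projection of $\ddot D$ on $\ddot Z$, and the 2SLS estimand controlling flexibly for $X$ is $\beta^{\text{2SLS}}=\operatorname{Var}(\ddot P)^{-1}\operatorname{Cov}(\ddot P,\ddot Y)$. *)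

theory Defs
  imports "HOL-Probability.Probability"
begin

text \<open>
  The treatment takes values in \<open>{..CARD('n)}\<close>, where \<open>'n\<close> indexes the \<open>n\<close> treatment effects;
  \<open>'m\<close> indexes the \<open>m\<close> components of the instrument.
\<close>

text \<open>
  Response types are mappings on \<open>\<Z>\<close>, hence extensional outside \<open>\<Z>\<close>: otherwise two HOL
  functions describing the same response type could differ. They are measurable so that the
  treatment a given type would take is itself a random variable.
\<close>

definition response_types ::
    "'z::topological_space set \<Rightarrow> nat \<Rightarrow> ('z \<Rightarrow> nat) set" where
  "response_types \<Z> n =
     (\<Z> \<rightarrow>\<^sub>E {..n}) \<inter> (restrict_space borel \<Z> \<rightarrow>\<^sub>M count_space {..n})"

definition given :: "'w measure \<Rightarrow> ('w \<Rightarrow> 'x) \<Rightarrow> 'x \<Rightarrow> 'w measure" where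
  "given M X x = uniform_measure M {\<omega> \<in> space M. X \<omega> = x}"

definition types_at ::
    "'w measure \<Rightarrow> ('z::topological_space set) \<Rightarrow> nat \<Rightarrow> ('w \<Rightarrow> 'z \<Rightarrow> nat) \<Rightarrow> ('w \<Rightarrow> 'x) \<Rightarrow> 'x \<Rightarrow> ('z \<Rightarrow> nat) set" where
  "types_at M \<Z> n S X x = {s \<in> response_types \<Z> n. \<P>(\<omega> in M. S \<omega> = s \<bar> X \<omega> = x) > 0}"

text \<open>
  Conditional independence given a discrete random variable \<open>X\<close>: independence of the two
  generated \<open>\<sigma>\<close>-algebras under the conditional law given \<open>X = x\<close>, for every atom \<open>x\<close>.
\<close>

definition cond_indep_discrete ::
    "'w measure \<Rightarrow> 'a measure \<Rightarrow> ('w \<Rightarrow> 'a) \<Rightarrow> 'b measure \<Rightarrow> ('w \<Rightarrow> 'b) \<Rightarrow> ('w \<Rightarrow> 'x) \<Rightarrow> bool" where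
  "cond_indep_discrete M MA A MB B X \<longleftrightarrow>
     (\<forall>x. \<P>(\<omega> in M. X \<omega> = x) > 0 \<longrightarrow>
        prob_space.indep_set (given M X x)
          (sets (vimage_algebra (space M) A MA)) (sets (vimage_algebra (space M) B MB)))"

definition finite_support :: "'w measure \<Rightarrow> ('w \<Rightarrow> 'x) \<Rightarrow> bool" where
  "finite_support M X \<longleftrightarrow> (\<exists>F. finite F \<and> (AE \<omega> in M. X \<omega> \<in> F))"

definition cov :: "'w measure \<Rightarrow> ('w \<Rightarrow> real) \<Rightarrow> ('w \<Rightarrow> real) \<Rightarrow> real" where
  "cov M f g = (\<integral>\<omega>. (f \<omega> - (\<integral>\<omega>'. f \<omega>' \<partial>M)) * (g \<omega> - (\<integral>\<omega>'. g \<omega>' \<partial>M)) \<partial>M)"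

definition Cov ::
    "'w measure \<Rightarrow> ('w \<Rightarrow> real^'a) \<Rightarrow> ('w \<Rightarrow> real^'b) \<Rightarrow> real^'b^'a" where
  "Cov M A B = (\<chi> i j. cov M (\<lambda>\<omega>. A \<omega> $ i) (\<lambda>\<omega>. B \<omega> $ j))"

definition Var :: "'w measure \<Rightarrow> ('w \<Rightarrow> real^'a) \<Rightarrow> real^'a^'a" where
  "Var M A = Cov M A A"

definition Cov_scalar :: "'w measure \<Rightarrow> ('w \<Rightarrow> real^'a) \<Rightarrow> ('w \<Rightarrow> real) \<Rightarrow> real^'a" where
  "Cov_scalar M A f = (\<chi> i. cov M (\<lambda>\<omega>. A \<omega> $ i) f)"

definition demean ::
    "'w measure \<Rightarrow> ('w \<Rightarrow> 'x::topological_space) \<Rightarrow> ('w \<Rightarrow> real) \<Rightarrow> 'w \<Rightarrow> real" where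
  "demean M X f = (\<lambda>\<omega>. f \<omega> - real_cond_exp M (vimage_algebra (space M) X borel) f \<omega>)"

definition demean_vec ::
    "'w measure \<Rightarrow> ('w \<Rightarrow> 'x::topological_space) \<Rightarrow> ('w \<Rightarrow> real^'a) \<Rightarrow> 'w \<Rightarrow> real^'a" where
  "demean_vec M X A = (\<lambda>\<omega>. \<chi> i. demean M X (\<lambda>\<omega>'. A \<omega>' $ i) \<omega>)"

definition indicators :: "('n \<Rightarrow> nat set) \<Rightarrow> nat \<Rightarrow> real^'n" where
  "indicators R t = (\<chi> k. indicator (R k) t)"

definition effects :: "(nat \<Rightarrow> 'w \<Rightarrow> real) \<Rightarrow> ('n \<Rightarrow> nat) \<Rightarrow> ('n \<Rightarrow> nat) \<Rightarrow> 'w \<Rightarrow> real^'n" where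
  "effects Yp hi lo \<omega> = (\<chi> k. Yp (hi k) \<omega> - Yp (lo k) \<omega>)"

definition potential_outcomes :: "nat \<Rightarrow> (nat \<Rightarrow> 'w \<Rightarrow> real) \<Rightarrow> 'w \<Rightarrow> (nat \<Rightarrow> real)" where
  "potential_outcomes n Yp \<omega> = (\<lambda>t\<in>{..n}. Yp t \<omega>)"

text \<open>
  In the following, \<open>A\<close>, \<open>B\<close> and \<open>f\<close> are the demeaned instrument, treatment indicators
  and outcome.
\<close>

definition lin_proj ::
    "'w measure \<Rightarrow> ('w \<Rightarrow> real^'m) \<Rightarrow> ('w \<Rightarrow> real^'n) \<Rightarrow> 'w \<Rightarrow> real^'n" where
  "lin_proj M A B = (\<lambda>\<omega>. (Cov M B A ** matrix_inv (Var M A)) *v A \<omega>)"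

definition tsls ::
    "'w measure \<Rightarrow> ('w \<Rightarrow> real^'m) \<Rightarrow> ('w \<Rightarrow> real^'n) \<Rightarrow> ('w \<Rightarrow> real) \<Rightarrow> real^'n" where
  "tsls M A B f =
     matrix_inv (Var M (lin_proj M A B)) *v Cov_scalar M (lin_proj M A B) f"

definition weight ::
    "'w measure \<Rightarrow> ('w \<Rightarrow> real^'m) \<Rightarrow> ('w \<Rightarrow> 'x) \<Rightarrow> ('n \<Rightarrow> nat set) \<Rightarrow> ('w \<Rightarrow> real^'n)
      \<Rightarrow> (real^'m \<Rightarrow> nat) \<Rightarrow> 'x \<Rightarrow> real^'n^'n" where
  "weight M Z X R P s x =
     matrix_inv (Var M P) ** Cov (given M X x) P (\<lambda>\<omega>. indicators R (s (Z \<omega>)))"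

definition mean_effect ::
    "'w measure \<Rightarrow> ('w \<Rightarrow> 's) \<Rightarrow> ('w \<Rightarrow> 'x) \<Rightarrow> ('w \<Rightarrow> real^'n) \<Rightarrow> 's \<Rightarrow> 'x \<Rightarrow> real^'n" where
  "mean_effect M S X b s x =
     (\<integral>\<omega>. b \<omega> \<partial>(uniform_measure M {\<omega> \<in> space M. S \<omega> = s \<and> X \<omega> = x}))"

end

theory Submission
  imports Defs
begin

text \<open>
  The effective weights come from evaluating both sides on the atoms \<open>{S = s, X = x}\<close>, which carry
  all the mass. Given \<open>X = x\<close>, the demeaned variables differ from the raw ones by constants, so
  \<open>P\<close> is a mean-zero function of \<open>Z\<close> there. Conditional independence of \<open>Z\<close> and
  \<open>(Y(0), \<dots>, Y(n), S)\<close> therefore removes \<open>\<alpha>\<close> and the demeaning constant from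
  \<open>E[1{S = s} P Y | X = x]\<close> and factors each remaining term
  \<open>E[1{S = s} P s\<^sub>k(Z) \<beta>\<^sub>k | X = x]\<close> into
  \<open>Cov(P, s\<^sub>k(Z) | X = x) E[1{S = s} \<beta>\<^sub>k | X = x]\<close>. Two integrable functions with equal integrals over
  all these atoms have the same conditional expectation given \<open>(S, X)\<close>, hence the same mean.
  For the invertibility of \<open>Var P\<close>: a vector in its kernel makes a linear combination of the demeaned
  instruments vanish almost surely, so nonsingularity of their variance and the rank condition
  force it to be zero.
\<close>

section \<open>Conditioning on atoms\<close>

text \<open>
  The density of \<open>uniform_measure M A\<close> for a null set \<open>A\<close> is \<open>\<infinity>\<close> on \<open>A\<close>, which still gives the zero
  measure; so integrals conditional on null events are \<open>0\<close>, not undefined.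
\<close>

lemma (in prob_space) uniform_measure_null_AE:
  assumes "A \<in> events" "prob A = 0"
  shows "AE \<omega> in uniform_measure M A. P \<omega>"
proof -
  have "AE \<omega> in M. \<omega> \<notin> A"
    using assms by (intro AE_not_in null_setsI) (auto simp: emeasure_eq_measure)
  then show ?thesis
    unfolding uniform_measure_def using assms by (subst AE_density) auto
qed

text \<open>Bochner integrals against a density need the density to be real-valued. Positive
  probability of \<open>A\<close> excludes the infinite value, so the extended quotient is the real
  one.\<close>

lemma (in prob_space) uniform_measure_eq_density:
  assumes "A \<in> events" "prob A \<noteq> 0"
  shows "uniform_measure M A = density M (\<lambda>\<omega>. ennreal (indicator A \<omega> / prob A))"
proof -
  have "indicator A \<omega> / emeasure M A = ennreal (indicator A \<omega> / prob A)" for \<omega>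
    using assms(2) divide_ennreal[of 1 "prob A"] zero_less_measure_iff[of M A]
    by (auto simp: emeasure_eq_measure indicator_def)
  then show ?thesis unfolding uniform_measure_def by simp
qed

text \<open>No positivity of \<open>prob A\<close> is required: for a null event the left side is
  \<open>0\<close> because the conditional measure vanishes, the right side because division by zero
  gives zero.\<close>

lemma (in prob_space) integral_uniform_measure:
  fixes f :: "'a \<Rightarrow> real"
  assumes "A \<in> events" "f \<in> borel_measurable M"
  shows "(\<integral>\<omega>. f \<omega> \<partial>uniform_measure M A) = (\<integral>\<omega>. indicator A \<omega> * f \<omega> \<partial>M) / prob A"
proof (cases "prob A = 0")
  case True
  have "(\<integral>\<omega>. f \<omega> \<partial>uniform_measure M A) = 0"
    by (rule integral_eq_zero_AE) (rule uniform_measure_null_AE[OF assms(1) True])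
  with True show ?thesis by simp
next
  case False
  show ?thesis
    unfolding uniform_measure_eq_density[OF assms(1) False] using assms
    by (subst integral_density) (auto simp: measure_nonneg)
qed

lemma (in prob_space) integrable_uniform_measure_iff:
  fixes f :: "'a \<Rightarrow> real"
  assumes "A \<in> events" "f \<in> borel_measurable M" "prob A \<noteq> 0"
  shows "integrable (uniform_measure M A) f \<longleftrightarrow> integrable M (\<lambda>\<omega>. indicator A \<omega> * f \<omega>)"
proof -
  have "integrable (uniform_measure M A) f \<longleftrightarrow> integrable M (\<lambda>\<omega>. (1 / prob A) * (indicator A \<omega> * f \<omega>))"
    unfolding uniform_measure_eq_density[OF assms(1,3)] using assms
    by (subst integrable_density) (auto simp: measure_nonneg)
  with assms(3) show ?thesis by (simp only: integrable_mult_left_iff) simp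
qed

lemma (in prob_space) integrable_uniform_measure:
  fixes f :: "'a \<Rightarrow> real"
  assumes "A \<in> events" "integrable M f"
  shows "integrable (uniform_measure M A) f"
proof (cases "prob A = 0")
  case True
  have "integrable (uniform_measure M A) (\<lambda>_. 0::real)" by simp
  then show ?thesis
    by (rule integrable_cong_AE_imp)
       (use assms in \<open>auto intro: uniform_measure_null_AE[OF assms(1) True]\<close>)
next
  case False
  with assms show ?thesis
    using integrable_mult_indicator[OF assms]
    by (subst integrable_uniform_measure_iff) auto
qed

section \<open>Conditional expectations on atoms of a random variable\<close>

lemma (in prob_space) sigma_finite_subalgebra_vimage:
  assumes "V \<in> measurable M N"
  shows "sigma_finite_subalgebra M (vimage_algebra (space M) V N)"
proof (rule finite_measure_subalgebra_is_sigma_finite)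
  have "sets (vimage_algebra (space M) V N) \<subseteq> events"
    unfolding sets_vimage_algebra using assms
    by (intro sets.sigma_sets_subset) auto
  then show "finite_measure_subalgebra M (vimage_algebra (space M) V N)"
    by unfold_locales (simp add: subalgebra_def)
qed

text \<open>A function measurable for the algebra generated by \<open>V\<close> is constant on every
  fibre of \<open>V\<close>, and the defining integral identity over the fibre fixes the constant.
  Hence the equation holds at every point of the fibre, not just almost everywhere.\<close>

lemma (in prob_space) real_cond_exp_on_atom:
  assumes V: "V \<in> measurable M N" and v: "{v} \<in> sets N" and f: "integrable M f"
    and w: "\<omega> \<in> space M" "V \<omega> = v" and pos: "prob {\<omega> \<in> space M. V \<omega> = v} \<noteq> 0"
  shows "real_cond_exp M (vimage_algebra (space M) V N) f \<omega>
    = (\<integral>\<omega>. f \<omega> \<partial>uniform_measure M {\<omega> \<in> space M. V \<omega> = v})"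
proof -
  let ?F = "vimage_algebra (space M) V N"
  let ?A = "{\<omega> \<in> space M. V \<omega> = v}"
  let ?g = "real_cond_exp M ?F f"
  interpret F: sigma_finite_subalgebra M ?F
    using V by (rule sigma_finite_subalgebra_vimage)
  have A_eq: "?A = V -` {v} \<inter> space M" by auto
  have AF: "?A \<in> sets ?F" unfolding A_eq using v by (rule in_vimage_algebra)
  have A: "?A \<in> events" unfolding A_eq using V v by (rule measurable_sets)
  have const: "?g \<omega>' = ?g \<omega>" if "\<omega>' \<in> ?A" for \<omega>'
  proof -
    \<comment> \<open>The level set of \<open>?g\<close> through \<open>\<omega>\<close> is the
      preimage under \<open>V\<close> of some \<open>B\<close>, and such a preimage cannot separate
      points at which \<open>V\<close> agrees.\<close>
    have "?g -` {?g \<omega>} \<inter> space ?F \<in> sets ?F"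
      by (rule measurable_sets[OF borel_measurable_cond_exp]) simp
    moreover have "V \<in> space M \<rightarrow> space N" using measurable_space[OF V] by blast
    ultimately obtain B where B: "?g -` {?g \<omega>} \<inter> space M = V -` B \<inter> space M"
      by (auto simp only: sets_vimage_algebra2 space_vimage_algebra)
    have "\<omega> \<in> V -` B \<inter> space M" unfolding B[symmetric] using w by simp
    then have "\<omega>' \<in> V -` B \<inter> space M" using that w by simp
    then show ?thesis unfolding B[symmetric] by simp
  qed
  have "(\<integral>\<omega>'. indicator ?A \<omega>' * f \<omega>' \<partial>M) = (\<integral>\<omega>'. indicator ?A \<omega>' * ?g \<omega>' \<partial>M)"
    using F.real_cond_exp_intA[OF f AF] by (simp add: set_lebesgue_integral_def)
  also have "\<dots> = (\<integral>\<omega>'. indicator ?A \<omega>' * ?g \<omega> \<partial>M)"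
    using const by (intro Bochner_Integration.integral_cong) (auto simp: indicator_def)
  also have "\<dots> = prob ?A * ?g \<omega>" using A by simp
  finally show ?thesis using pos f A by (simp add: integral_uniform_measure)
qed

lemma (in prob_space) AE_real_cond_exp_atomic:
  assumes V: "V \<in> measurable M N" and sing: "\<And>v. v \<in> space N \<Longrightarrow> {v} \<in> sets N"
    and atomic: "AE \<omega> in M. prob {\<omega>' \<in> space M. V \<omega>' = V \<omega>} \<noteq> 0"
    and f: "integrable M f"
  shows "AE \<omega> in M. real_cond_exp M (vimage_algebra (space M) V N) f \<omega>
      = (\<integral>\<omega>'. f \<omega>' \<partial>uniform_measure M {\<omega>' \<in> space M. V \<omega>' = V \<omega>})"
proof -
  show ?thesis
    using atomic AE_space
  proof eventually_elim
    case (elim \<omega>)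
    with V have "V \<omega> \<in> space N" by (auto dest: measurable_space)
    with elim show ?case by (intro real_cond_exp_on_atom V sing f) auto
  qed
qed

text \<open>Both functions have almost surely the same conditional expectation given
  \<open>V\<close>, and the tower property compares the means. This avoids enumerating the atoms,
  whose labels may come from an uncountable space.\<close>

lemma (in prob_space) integral_eq_if_eq_on_atoms:
  fixes f g :: "'a \<Rightarrow> real"
  assumes V: "V \<in> measurable M N" and sing: "\<And>v. v \<in> space N \<Longrightarrow> {v} \<in> sets N"
    and atomic: "AE \<omega> in M. prob {\<omega>' \<in> space M. V \<omega>' = V \<omega>} \<noteq> 0"
    and f: "integrable M f" and g: "integrable M g"
    and eq: "\<And>v. prob {\<omega> \<in> space M. V \<omega> = v} \<noteq> 0 \<Longrightarrow>
      (\<integral>\<omega>. f \<omega> \<partial>uniform_measure M {\<omega> \<in> space M. V \<omega> = v})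
      = (\<integral>\<omega>. g \<omega> \<partial>uniform_measure M {\<omega> \<in> space M. V \<omega> = v})"
  shows "integral\<^sup>L M f = integral\<^sup>L M g"
proof -
  let ?F = "vimage_algebra (space M) V N"
  interpret F: sigma_finite_subalgebra M ?F
    using V by (rule sigma_finite_subalgebra_vimage)
  have rce: "AE \<omega> in M. real_cond_exp M ?F h \<omega>
      = (\<integral>\<omega>'. h \<omega>' \<partial>uniform_measure M {\<omega>' \<in> space M. V \<omega>' = V \<omega>})"
    if "integrable M h" for h
    using V sing atomic that by (rule AE_real_cond_exp_atomic)
  have "AE \<omega> in M. real_cond_exp M ?F f \<omega> = real_cond_exp M ?F g \<omega>"
    using rce[OF f] rce[OF g] atomic
    by eventually_elim (simp add: eq)
  then have "integral\<^sup>L M (real_cond_exp M ?F f) = integral\<^sup>L M (real_cond_exp M ?F g)"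
    by (intro integral_cong_AE) auto
  then show ?thesis by (simp add: F.real_cond_exp_int f g)
qed

section \<open>Integrability and measurability with finitely many atoms\<close>

lemma (in prob_space) AE_eq_sum_atoms:
  fixes f :: "'a \<Rightarrow> real"
  assumes "finite F" "AE \<omega> in M. X \<omega> \<in> F"
  shows "AE \<omega> in M. f \<omega> = (\<Sum>x\<in>F. indicator {\<omega> \<in> space M. X \<omega> = x} \<omega> * f \<omega>)"
  using assms(2) AE_space
proof eventually_elim
  case (elim \<omega>)
  have "(\<Sum>x\<in>F. indicator {\<omega> \<in> space M. X \<omega> = x} \<omega> * f \<omega>) = (\<Sum>x\<in>F. if x = X \<omega> then f \<omega> else 0)"
    using elim by (intro sum.cong) auto
  with elim assms(1) show ?case by simp
qed

text \<open>Almost everywhere \<open>f\<close> is the sum of its restrictions to the atoms, and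
  finiteness of \<open>F\<close> makes the sum integrable. Null atoms contribute functions that
  vanish almost surely.\<close>

lemma (in prob_space) integrable_if_integrable_on_atoms:
  fixes f :: "'a \<Rightarrow> real"
  assumes F: "finite F" "AE \<omega> in M. X \<omega> \<in> F" and X: "X \<in> measurable M N"
    and sing: "\<And>x. x \<in> F \<Longrightarrow> {x} \<in> sets N"
    and f: "f \<in> borel_measurable M"
    and int: "\<And>x. x \<in> F \<Longrightarrow> prob {\<omega> \<in> space M. X \<omega> = x} \<noteq> 0 \<Longrightarrow>
      integrable (uniform_measure M {\<omega> \<in> space M. X \<omega> = x}) f"
  shows "integrable M f"
proof -
  have ev: "{\<omega> \<in> space M. X \<omega> = x} \<in> events" if "x \<in> F" for x
  proof -
    have "{\<omega> \<in> space M. X \<omega> = x} = X -` {x} \<inter> space M" by auto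
    then show ?thesis using measurable_sets[OF X sing[OF that]] by simp
  qed
  have "integrable M (\<lambda>\<omega>. indicator {\<omega> \<in> space M. X \<omega> = x} \<omega> * f \<omega>)" if "x \<in> F" for x
  proof (cases "prob {\<omega> \<in> space M. X \<omega> = x} = 0")
    case True
    then have "AE \<omega> in M. \<omega> \<notin> {\<omega> \<in> space M. X \<omega> = x}"
      using ev[OF that] by (intro AE_not_in null_setsI) (auto simp: emeasure_eq_measure)
    then have "AE \<omega> in M. 0 = indicator {\<omega> \<in> space M. X \<omega> = x} \<omega> * f \<omega>"
      by eventually_elim auto
    then show ?thesis
      using ev[OF that] f by (intro integrable_cong_AE_imp[OF integrable_zero]) auto
  next
    case False
    show ?thesis
      using integrable_uniform_measure_iff[OF ev[OF that] f False] int[OF that False] by simp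
  qed
  then have int_sum: "integrable M (\<lambda>\<omega>. \<Sum>x\<in>F. indicator {\<omega> \<in> space M. X \<omega> = x} \<omega> * f \<omega>)"
    by (rule Bochner_Integration.integrable_sum)
  then show ?thesis
    by (rule integrable_cong_AE_imp) (use f AE_eq_sum_atoms[OF F, of f] in auto)
qed

text \<open>Conditioning in two stages, first on \<open>A\<close> and then on \<open>B\<close>. If
  the intersection is null, both sides are \<open>0\<close> by the convention on division.\<close>

lemma (in prob_space) integral_uniform_measure_Int:
  fixes f :: "'a \<Rightarrow> real"
  assumes A: "A \<in> events" "prob A \<noteq> 0" and B: "B \<in> events" and f: "f \<in> borel_measurable M"
  shows "(\<integral>\<omega>. f \<omega> \<partial>uniform_measure M (A \<inter> B)) =
    (\<integral>\<omega>. indicator B \<omega> * f \<omega> \<partial>uniform_measure M A) / measure (uniform_measure M A) B"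
proof -
  have "(\<integral>\<omega>. indicator B \<omega> * f \<omega> \<partial>uniform_measure M A)
      = (\<integral>\<omega>. indicator (A \<inter> B) \<omega> * f \<omega> \<partial>M) / prob A"
    using A B f by (simp add: integral_uniform_measure indicator_inter_arith mult.assoc)
  moreover have "measure (uniform_measure M A) B = prob (A \<inter> B) / prob A"
    using A B by (simp add: emeasure_eq_measure)
  ultimately show ?thesis
    using A B f by (simp add: integral_uniform_measure)
qed

text \<open>No regularity of \<open>g\<close> enters: any function of \<open>S\<close> is measurable
  because the target is a counting space, and the dependence on \<open>X\<close> is a finite sum of
  indicators.\<close>

lemma (in prob_space) borel_measurable_finite_atoms:
  fixes g :: "'s \<Rightarrow> 'x \<Rightarrow> real"
  assumes F: "finite F" and S: "S \<in> measurable M (count_space K)"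
    and X: "X \<in> measurable M N" and sing: "\<And>x. x \<in> F \<Longrightarrow> {x} \<in> sets N"
    and zero: "\<And>s x. x \<notin> F \<Longrightarrow> g s x = 0"
  shows "(\<lambda>\<omega>. g (S \<omega>) (X \<omega>)) \<in> borel_measurable M"
proof -
  have "(\<lambda>\<omega>. \<Sum>x\<in>F. indicator {x} (X \<omega>) * g (S \<omega>) x) \<in> borel_measurable M"
  proof (intro borel_measurable_sum borel_measurable_times)
    fix x assume "x \<in> F"
    then show "(\<lambda>\<omega>. indicator {x} (X \<omega>) :: real) \<in> borel_measurable M"
      by (intro measurable_compose[OF X] borel_measurable_indicator sing)
    show "(\<lambda>\<omega>. g (S \<omega>) x) \<in> borel_measurable M"
      by (rule measurable_compose[OF S]) simp
  qed
  moreover have "(\<Sum>x\<in>F. indicator {x} (X \<omega>) * g (S \<omega>) x) = g (S \<omega>) (X \<omega>)" for \<omega>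
  proof -
    have "(\<Sum>x\<in>F. indicator {x} (X \<omega>) * g (S \<omega>) x)
        = (\<Sum>x\<in>F. if x = X \<omega> then g (S \<omega>) (X \<omega>) else 0)"
      by (intro sum.cong) auto
    then show ?thesis using F zero by simp
  qed
  ultimately show ?thesis by simp
qed

section \<open>Independence given the controls\<close>

text \<open>A measurable function of \<open>A\<close> generates a smaller algebra than
  \<open>A\<close> does, likewise for \<open>B\<close>, and independence passes to smaller
  algebras.\<close>

lemma (in prob_space) cond_indep_discrete_imp_indep_var:
  assumes ci: "cond_indep_discrete M MA A MB B X"
    and A: "A \<in> measurable M MA" and B: "B \<in> measurable M MB"
    and G: "G \<in> measurable MA N" and H: "H \<in> measurable MB N"
    and pos: "prob {\<omega> \<in> space M. X \<omega> = x} \<noteq> 0"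
  shows "prob_space.indep_var (given M X x) N (\<lambda>\<omega>. G (A \<omega>)) N (\<lambda>\<omega>. H (B \<omega>))"
proof -
  have "emeasure M {\<omega> \<in> space M. X \<omega> = x} \<noteq> 0"
    using pos by (simp add: emeasure_eq_measure)
  then have "prob_space (given M X x)"
    unfolding given_def by (intro prob_space_uniform_measure) auto
  then interpret Q: prob_space "given M X x" .
  have sp: "space (given M X x) = space M" and st: "sets (given M X x) = sets M"
    by (simp_all add: given_def)
  have ind: "Q.indep_set (sets (vimage_algebra (space M) A MA)) (sets (vimage_algebra (space M) B MB))"
    using ci pos unfolding cond_indep_discrete_def by (auto simp: zero_less_measure_iff)
  have sub: "sigma_sets (space M) {(\<lambda>\<omega>. K (C \<omega>)) -` U \<inter> space M |U. U \<in> sets N}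
      \<subseteq> sets (vimage_algebra (space M) C MC)"
    if "C \<in> measurable M MC" "K \<in> measurable MC N" for C K MC
  proof -
    have "C \<in> measurable (vimage_algebra (space M) C MC) MC"
      using measurable_space[OF that(1)] by (intro measurable_vimage_algebra1) auto
    then have "(\<lambda>\<omega>. K (C \<omega>)) \<in> measurable (vimage_algebra (space M) C MC) N"
      using that(2) by (rule measurable_compose)
    from measurable_sets[OF this]
    have "{(\<lambda>\<omega>. K (C \<omega>)) -` U \<inter> space M |U. U \<in> sets N}
        \<subseteq> sets (vimage_algebra (space M) C MC)"
      unfolding space_vimage_algebra by blast
    from sets.sigma_sets_subset[OF this] show ?thesis
      unfolding space_vimage_algebra .
  qed
  have "Q.indep_set (sigma_sets (space M) {(\<lambda>\<omega>. G (A \<omega>)) -` U \<inter> space M |U. U \<in> sets N})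
      (sigma_sets (space M) {(\<lambda>\<omega>. H (B \<omega>)) -` U \<inter> space M |U. U \<in> sets N})"
    using ind sub[OF A G] sub[OF B H] unfolding Q.indep_sets2_eq by blast
  moreover have "(\<lambda>\<omega>. G (A \<omega>)) \<in> measurable (given M X x) N"
    "(\<lambda>\<omega>. H (B \<omega>)) \<in> measurable (given M X x) N"
    using measurable_compose[OF A G] measurable_compose[OF B H]
    by (simp_all add: measurable_cong_sets[OF st refl])
  ultimately show ?thesis
    unfolding Q.indep_var_eq sp by simp
qed

section \<open>Coordinatewise integrals and products of square integrable functions\<close>

text \<open>The expansion in the standard basis is a finite sum, which gives integrability; the
  coordinate map is bounded linear and so commutes with the integral.\<close>

lemma
  fixes f :: "'w \<Rightarrow> real^'n"
  assumes "\<And>i. integrable M (\<lambda>\<omega>. f \<omega> $ i)"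
  shows integrable_vecI: "integrable M f"
    and integral_vec_nth: "(\<integral>\<omega>. f \<omega> \<partial>M) $ i = (\<integral>\<omega>. f \<omega> $ i \<partial>M)"
proof -
  have "integrable M (\<lambda>\<omega>. \<Sum>i\<in>UNIV. f \<omega> $ i *\<^sub>R (axis i 1 :: real^'n))"
    using assms by auto
  moreover have "(\<Sum>i\<in>UNIV. f \<omega> $ i *\<^sub>R (axis i 1 :: real^'n)) = f \<omega>" for \<omega>
    using basis_expansion[of "f \<omega>"] by (simp add: scalar_mult_eq_scaleR)
  ultimately show int: "integrable M f" by simp
  show "(\<integral>\<omega>. f \<omega> \<partial>M) $ i = (\<integral>\<omega>. f \<omega> $ i \<partial>M)"
    using integral_bounded_linear[OF bounded_linear_vec_nth int, of i] by simp
qed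

lemma integrable_mult_if_square_integrable:
  fixes f g :: "'w \<Rightarrow> real"
  assumes "f \<in> borel_measurable M" "g \<in> borel_measurable M"
    and "integrable M (\<lambda>\<omega>. (f \<omega>)\<^sup>2)" "integrable M (\<lambda>\<omega>. (g \<omega>)\<^sup>2)"
  shows "integrable M (\<lambda>\<omega>. f \<omega> * g \<omega>)"
proof (rule Bochner_Integration.integrable_bound)
  show "integrable M (\<lambda>\<omega>. (f \<omega>)\<^sup>2 + (g \<omega>)\<^sup>2)" using assms by simp
  have "\<bar>a * b\<bar> \<le> a\<^sup>2 + b\<^sup>2" for a b :: real
  proof -
    have "2 * (\<bar>a\<bar> * \<bar>b\<bar>) \<le> a\<^sup>2 + b\<^sup>2" using sum_squares_bound[of "\<bar>a\<bar>" "\<bar>b\<bar>"] by simp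
    moreover have "0 \<le> \<bar>a\<bar> * \<bar>b\<bar>" by simp
    ultimately show ?thesis unfolding abs_mult by linarith
  qed
  then show "AE \<omega> in M. norm (f \<omega> * g \<omega>) \<le> norm ((f \<omega>)\<^sup>2 + (g \<omega>)\<^sup>2)"
    by simp
qed (use assms in simp)

section \<open>Nonsingularity of the variance of a linear projection\<close>

text \<open>With \<open>W\<close> the centred vector, the quadratic form of the variance at
  \<open>u\<close> is the mean of the square of the inner product of \<open>W\<close> and
  \<open>u\<close>. A null quadratic form thus forces that inner product to vanish almost
  surely.\<close>

lemma (in prob_space) Var_mult_vec_eq_0_iff:
  fixes V :: "'a \<Rightarrow> real^'n"
  assumes meas: "\<And>i. (\<lambda>\<omega>. V \<omega> $ i) \<in> borel_measurable M"
    and sq: "\<And>i. integrable M (\<lambda>\<omega>. (V \<omega> $ i)\<^sup>2)"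
  shows "Var M V *v u = 0 \<longleftrightarrow> (AE \<omega> in M. (V \<omega> - (\<chi> i. expectation (\<lambda>\<omega>. V \<omega> $ i))) \<bullet> u = 0)"
proof -
  define W where "W \<omega> = V \<omega> - (\<chi> i. expectation (\<lambda>\<omega>. V \<omega> $ i))" for \<omega>
  have int: "integrable M (\<lambda>\<omega>. V \<omega> $ i)" for i
    by (rule square_integrable_imp_integrable[OF meas sq])
  have W_meas [measurable]: "(\<lambda>\<omega>. W \<omega> $ i) \<in> borel_measurable M" for i
    using meas[of i] unfolding W_def by simp
  have W_sq: "integrable M (\<lambda>\<omega>. (W \<omega> $ i)\<^sup>2)" for i
    unfolding W_def using int[of i] sq[of i] by (simp add: power2_diff)
  have W_prod: "integrable M (\<lambda>\<omega>. W \<omega> $ i * W \<omega> $ j)" for i j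
    by (intro integrable_mult_if_square_integrable W_sq W_meas)
  have inner: "W \<omega> \<bullet> u = (\<Sum>j\<in>UNIV. W \<omega> $ j * u $ j)" for \<omega>
    by (simp add: inner_vec_def)
  have Wu_meas [measurable]: "(\<lambda>\<omega>. W \<omega> \<bullet> u) \<in> borel_measurable M"
    unfolding inner by measurable
  have Var_nth: "(Var M V *v u) $ i = (\<integral>\<omega>. W \<omega> $ i * (W \<omega> \<bullet> u) \<partial>M)" for i
  proof -
    have "(Var M V *v u) $ i = (\<Sum>j\<in>UNIV. (\<integral>\<omega>. W \<omega> $ i * W \<omega> $ j \<partial>M) * u $ j)"
      by (simp add: matrix_vector_mult_def Var_def Cov_def cov_def W_def)
    also have "\<dots> = (\<integral>\<omega>. (\<Sum>j\<in>UNIV. W \<omega> $ i * W \<omega> $ j * u $ j) \<partial>M)"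
      using W_prod by (subst Bochner_Integration.integral_sum) auto
    finally show ?thesis by (simp add: inner sum_distrib_left mult.assoc)
  qed
  have Wi_int: "integrable M (\<lambda>\<omega>. W \<omega> $ i * (W \<omega> \<bullet> u))" for i
  proof -
    have "integrable M (\<lambda>\<omega>. \<Sum>j\<in>UNIV. W \<omega> $ i * W \<omega> $ j * u $ j)"
      using W_prod by auto
    then show ?thesis by (simp add: inner sum_distrib_left mult.assoc)
  qed
  have sq_eq: "(\<Sum>i\<in>UNIV. W \<omega> $ i * (W \<omega> \<bullet> u) * u $ i) = (W \<omega> \<bullet> u)\<^sup>2" for \<omega>
  proof -
    have "(\<Sum>i\<in>UNIV. W \<omega> $ i * (W \<omega> \<bullet> u) * u $ i) = (\<Sum>i\<in>UNIV. W \<omega> $ i * u $ i) * (W \<omega> \<bullet> u)"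
      unfolding sum_distrib_right by (intro sum.cong) auto
    then show ?thesis by (simp add: inner power2_eq_square)
  qed
  show ?thesis
    unfolding W_def[symmetric]
  proof
    assume null: "Var M V *v u = 0"
    have "0 = (\<Sum>i\<in>UNIV. (\<integral>\<omega>. W \<omega> $ i * (W \<omega> \<bullet> u) \<partial>M) * u $ i)"
      using null by (simp flip: Var_nth)
    also have "\<dots> = (\<integral>\<omega>. (\<Sum>i\<in>UNIV. W \<omega> $ i * (W \<omega> \<bullet> u) * u $ i) \<partial>M)"
      using Wi_int by (subst Bochner_Integration.integral_sum) auto
    finally have "(\<integral>\<omega>. (W \<omega> \<bullet> u)\<^sup>2 \<partial>M) = 0" by (simp add: sq_eq)
    moreover have "integrable M (\<lambda>\<omega>. \<Sum>i\<in>UNIV. W \<omega> $ i * (W \<omega> \<bullet> u) * u $ i)"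
      using Wi_int by auto
    then have "integrable M (\<lambda>\<omega>. (W \<omega> \<bullet> u)\<^sup>2)" by (simp add: sq_eq)
    ultimately have "AE \<omega> in M. (W \<omega> \<bullet> u)\<^sup>2 = 0"
      using integral_nonneg_eq_0_iff_AE[of M "\<lambda>\<omega>. (W \<omega> \<bullet> u)\<^sup>2"] by simp
    then show "AE \<omega> in M. W \<omega> \<bullet> u = 0" by simp
  next
    assume "AE \<omega> in M. W \<omega> \<bullet> u = 0"
    then have "(\<integral>\<omega>. W \<omega> $ i * (W \<omega> \<bullet> u) \<partial>M) = 0" for i
      by (intro integral_eq_zero_AE) auto
    then show "Var M V *v u = 0" by (simp add: vec_eq_iff Var_nth)
  qed
qed

lemma invertible_mult_vec_eq_0_iff:
  fixes A :: "real^'n^'n"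
  assumes "invertible A"
  shows "A *v x = 0 \<longleftrightarrow> x = 0"
proof
  assume "A *v x = 0"
  moreover obtain B where "B ** A = mat 1" using assms unfolding invertible_def by blast
  then have "x = B *v (A *v x)" by (simp add: matrix_vector_mul_assoc)
  ultimately show "x = 0" by simp
qed simp

lemma invertible_if_ker_trivial:
  fixes A :: "real^'n^'n"
  assumes "\<And>x. A *v x = 0 \<Longrightarrow> x = 0"
  shows "invertible A"
  using assms by (simp add: invertible_left_inverse matrix_left_invertible_ker)

lemma invertible_matrix_inv:
  fixes A :: "real^'n^'n"
  assumes "invertible A"
  shows "invertible (matrix_inv A)"
proof -
  \<comment> \<open>\<open>matrix_inv\<close> chooses some two-sided inverse, so it has the inverse
    property as soon as one exists.\<close>
  have "A ** matrix_inv A = mat 1 \<and> matrix_inv A ** A = mat 1"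
    unfolding matrix_inv_def using assms unfolding invertible_def by (rule someI_ex)
  then show ?thesis unfolding invertible_def by blast
qed

lemma transpose_Cov: "transpose (Cov M A B) = Cov M B A"
  by (simp add: transpose_def Cov_def cov_def vec_eq_iff mult.commute)

text \<open>\<open>Var_mult_vec_eq_0_iff\<close> is used in both directions: it reads a kernel
  vector of the variance of the projection as almost sure vanishing, then returns to the kernel of
  \<open>Var M A\<close>.\<close>

lemma (in prob_space) invertible_Var_lin_proj:
  fixes A :: "'a \<Rightarrow> real^'m" and B :: "'a \<Rightarrow> real^'n"
  assumes meas: "\<And>i. (\<lambda>\<omega>. A \<omega> $ i) \<in> borel_measurable M"
    and sq: "\<And>i. integrable M (\<lambda>\<omega>. (A \<omega> $ i)\<^sup>2)"
    and inv: "invertible (Var M A)" and rank: "rank (Cov M A B) = CARD('n)"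
  shows "invertible (Var M (lin_proj M A B))"
proof (rule invertible_if_ker_trivial)
  fix v assume v: "Var M (lin_proj M A B) *v v = 0"
  define L where "L = Cov M B A ** matrix_inv (Var M A)"
  define P where "P = lin_proj M A B"
  have P: "P \<omega> = L *v A \<omega>" for \<omega> by (simp add: P_def lin_proj_def L_def)
  have P_nth: "P \<omega> $ i = (\<Sum>j\<in>UNIV. L $ i $ j * A \<omega> $ j)" for \<omega> i
    by (simp add: P matrix_vector_mult_def)
  have A_prod: "integrable M (\<lambda>\<omega>. A \<omega> $ i * A \<omega> $ j)" for i j
    by (intro integrable_mult_if_square_integrable sq meas)
  have A_int: "integrable M (\<lambda>\<omega>. A \<omega> $ i)" for i
    by (rule square_integrable_imp_integrable[OF meas sq])
  have "integrable M (\<lambda>\<omega>. \<Sum>j\<in>UNIV. \<Sum>k\<in>UNIV. (L $ i $ j * L $ i $ k) * (A \<omega> $ j * A \<omega> $ k))" for i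
    using A_prod by auto
  then have P_sq: "integrable M (\<lambda>\<omega>. (P \<omega> $ i)\<^sup>2)" for i
    by (simp add: P_nth power2_eq_square sum_product mult_ac)
  have P_meas: "(\<lambda>\<omega>. P \<omega> $ i) \<in> borel_measurable M" for i
    unfolding P_nth using meas by simp
  have mean: "(\<chi> i. expectation (\<lambda>\<omega>. P \<omega> $ i)) = L *v (\<chi> i. expectation (\<lambda>\<omega>. A \<omega> $ i))"
    using A_int by (simp add: vec_eq_iff P_nth matrix_vector_mult_def)
  have "AE \<omega> in M. (P \<omega> - (\<chi> i. expectation (\<lambda>\<omega>. P \<omega> $ i))) \<bullet> v = 0"
    using v P_meas P_sq unfolding P_def[symmetric] by (subst (asm) Var_mult_vec_eq_0_iff) auto
  \<comment> \<open>Moving \<open>L\<close> to the other side of the inner product turns a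
    combination of the components of \<open>P\<close> into one of the components of
    \<open>A\<close>.\<close>
  moreover have "(P \<omega> - (\<chi> i. expectation (\<lambda>\<omega>. P \<omega> $ i))) \<bullet> v
      = (A \<omega> - (\<chi> i. expectation (\<lambda>\<omega>. A \<omega> $ i))) \<bullet> (transpose L *v v)" for \<omega>
    unfolding mean unfolding P matrix_vector_mult_diff_distrib[symmetric]
    by (simp add: dot_lmul_matrix[symmetric] inner_commute)
  ultimately have "Var M A *v (transpose L *v v) = 0"
    using meas sq by (subst Var_mult_vec_eq_0_iff) auto
  then have "transpose L *v v = 0"
    by (simp add: invertible_mult_vec_eq_0_iff[OF inv])
  \<comment> \<open>Transposing \<open>L\<close> yields \<open>Cov M A B\<close> preceded by a
    transposed inverse, which is itself injective and cancels.\<close>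
  then have "transpose (matrix_inv (Var M A)) *v (Cov M A B *v v) = 0"
    by (simp add: L_def matrix_transpose_mul transpose_Cov matrix_vector_mul_assoc
        del: vector_transpose_matrix)
  then have "Cov M A B *v v = 0"
    using invertible_mult_vec_eq_0_iff[OF transpose_invertible[OF invertible_matrix_inv[OF inv]]]
    by blast
  moreover have "inj ((*v) (Cov M A B))" using rank by (simp add: full_rank_injective)
  ultimately show "v = 0"
    by (metis injD matrix_vector_mult_0_right)
qed

section \<open>Response types with discrete controls\<close>

text \<open>\<open>types\<close> places almost every outcome in an event of positive probability on
  which both \<open>S\<close> and \<open>X\<close> are constant, so conditioning on a type is
  elementary. Since \<open>\<alpha>\<close> acts on the family of potential outcomes,
  \<open>exogeneity\<close> covers the intercept as well as the effects.\<close>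

locale controlled_response = prob_space M for M :: "'w measure" +
  fixes \<Z> :: "(real^'m) set" and n :: nat
    and Z :: "'w \<Rightarrow> real^'m" and X :: "'w \<Rightarrow> real^'q"
    and S :: "'w \<Rightarrow> real^'m \<Rightarrow> nat" and T :: "'w \<Rightarrow> nat"
    and Yp :: "nat \<Rightarrow> 'w \<Rightarrow> real" and Y :: "'w \<Rightarrow> real"
    and R :: "'n::finite \<Rightarrow> nat set" and hi lo :: "'n \<Rightarrow> nat"
    and \<alpha> :: "(nat \<Rightarrow> real) \<Rightarrow> real"
  assumes Z: "Z \<in> M \<rightarrow>\<^sub>M restrict_space borel \<Z>"
    and X: "X \<in> M \<rightarrow>\<^sub>M borel" and finite_support: "finite_support M X"
    and T: "T \<in> M \<rightarrow>\<^sub>M count_space {..n}"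
    and S: "S \<in> M \<rightarrow>\<^sub>M count_space (response_types \<Z> n)"
    and types: "AE \<omega> in M. S \<omega> \<in> types_at M \<Z> n S X (X \<omega>)"
    and T_eq: "\<And>\<omega>. \<omega> \<in> space M \<Longrightarrow> T \<omega> = S \<omega> (Z \<omega>)"
    and Y_eq: "\<And>\<omega>. \<omega> \<in> space M \<Longrightarrow> Y \<omega> = Yp (T \<omega>) \<omega>"
    and hi: "\<And>k. hi k \<le> n" and lo: "\<And>k. lo k \<le> n"
    and \<alpha>: "\<alpha> \<in> borel_measurable (PiM {..n} (\<lambda>_. borel))"
    and Y_decomp: "\<And>\<omega>. \<omega> \<in> space M \<Longrightarrow>
      Y \<omega> = \<alpha> (potential_outcomes n Yp \<omega>)
        + (\<Sum>k\<in>UNIV. indicators R (T \<omega>) $ k * effects Yp hi lo \<omega> $ k)"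
    and Yp_int: "\<And>t. t \<le> n \<Longrightarrow> integrable M (Yp t)"
    and Z_sq: "\<And>i. integrable M (\<lambda>\<omega>. (Z \<omega> $ i)\<^sup>2)"
    and exogeneity: "cond_indep_discrete M
         (PiM {..n} (\<lambda>_. borel) \<Otimes>\<^sub>M count_space (response_types \<Z> n))
         (\<lambda>\<omega>. (potential_outcomes n Yp \<omega>, S \<omega>))
         (restrict_space borel \<Z>) Z X"
begin

abbreviation "atom x \<equiv> {\<omega> \<in> space M. X \<omega> = x}"
abbreviation "atoms \<equiv> {x. prob (atom x) \<noteq> 0}"
abbreviation "type_is s \<equiv> {\<omega> \<in> space M. S \<omega> = s}"
abbreviation "types \<equiv> response_types \<Z> n"
abbreviation "potential \<equiv> PiM {..n} (\<lambda>_. borel :: real measure) \<Otimes>\<^sub>M count_space types"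
abbreviation "\<beta> \<equiv> effects Yp hi lo"
abbreviation "pot \<omega> \<equiv> (potential_outcomes n Yp \<omega>, S \<omega>)"

section \<open>Events, atoms and integrability in the model\<close>

lemma Z_borel [measurable]: "Z \<in> borel_measurable M"
  using Z by (simp add: measurable_restrict_space2_iff)

lemma Z_nth_borel [measurable]: "(\<lambda>\<omega>. Z \<omega> $ i) \<in> borel_measurable M"
  by (rule measurable_compose[OF Z_borel], rule borel_measurable_continuous_onI)
    (rule continuous_on_component[OF continuous_on_id])

lemma Z_int: "integrable M (\<lambda>\<omega>. Z \<omega> $ i)"
  by (rule square_integrable_imp_integrable[OF Z_nth_borel Z_sq])

lemma atom_event [measurable]: "atom x \<in> events"
proof -
  have "atom x = X -` {x} \<inter> space M" by auto
  then show ?thesis using measurable_sets[OF X, of "{x}"] by simp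
qed

lemma type_is_event [measurable]: "s \<in> types \<Longrightarrow> type_is s \<in> events"
proof -
  assume "s \<in> types"
  moreover have "type_is s = S -` {s} \<inter> space M" by auto
  ultimately show ?thesis using measurable_sets[OF S, of "{s}"] by simp
qed

lemma T_event [measurable]: "{\<omega> \<in> space M. T \<omega> \<in> A} \<in> events"
proof -
  have "{\<omega> \<in> space M. T \<omega> \<in> A} = T -` (A \<inter> {..n}) \<inter> space M"
    using measurable_space[OF T] by auto
  then show ?thesis using measurable_sets[OF T, of "A \<inter> {..n}"] by simp
qed

lemma finite_atoms: "finite atoms" and AE_atoms: "AE \<omega> in M. X \<omega> \<in> atoms"
proof -
  obtain F where F: "finite F" "AE \<omega> in M. X \<omega> \<in> F"
    using finite_support unfolding finite_support_def by blast
  have "atoms \<subseteq> F"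
  proof safe
    fix x assume x: "prob (atom x) \<noteq> 0"
    show "x \<in> F"
    proof (rule ccontr)
      assume "x \<notin> F"
      have "AE \<omega> in M. \<omega> \<notin> atom x"
        using F(2) by eventually_elim (use \<open>x \<notin> F\<close> in auto)
      then have "prob (atom x) = 0" by (simp add: AE_iff_measurable[OF atom_event] measure_def)
      with x show False by contradiction
    qed
  qed
  then show "finite atoms" using F(1) by (rule finite_subset)
  \<comment> \<open>A conditional probability given a null event is a division by zero, hence
    \<open>0\<close>; a positive one therefore shows that the control value is an atom.\<close>
  show "AE \<omega> in M. X \<omega> \<in> atoms"
    using types
    by eventually_elim (auto simp: types_at_def cond_prob_def)
qed

text \<open>A positive conditional probability of the realized type has a positive numerator, which
  is the probability of the joint event.\<close>

lemma AE_joint_atoms: "AE \<omega> in M. prob {\<omega>' \<in> space M. (S \<omega>', X \<omega>') = (S \<omega>, X \<omega>)} \<noteq> 0"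
  using types by eventually_elim (auto simp: types_at_def cond_prob_def)

lemma SX_measurable: "(\<lambda>\<omega>. (S \<omega>, X \<omega>)) \<in> M \<rightarrow>\<^sub>M count_space types \<Otimes>\<^sub>M borel"
  using S X by simp

lemma SX_sing:
  "v \<in> space (count_space types \<Otimes>\<^sub>M (borel :: (real^'q) measure)) \<Longrightarrow>
    {v} \<in> sets (count_space types \<Otimes>\<^sub>M borel)"
proof -
  assume "v \<in> space (count_space types \<Otimes>\<^sub>M (borel :: (real^'q) measure))"
  then have "{fst v} \<times> {snd v} \<in> sets (count_space types \<Otimes>\<^sub>M (borel :: (real^'q) measure))"
    by (intro pair_measureI) (auto simp: space_pair_measure)
  then show ?thesis by simp
qed

lemma Yp_borel: "t \<le> n \<Longrightarrow> Yp t \<in> borel_measurable M"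
  using Yp_int by (rule borel_measurable_integrable)

lemma potential_outcomes_measurable: "potential_outcomes n Yp \<in> M \<rightarrow>\<^sub>M PiM {..n} (\<lambda>_. borel)"
  unfolding potential_outcomes_def by (rule measurable_restrict) (auto intro: Yp_borel)

lemma pot_measurable: "pot \<in> M \<rightarrow>\<^sub>M potential"
  using potential_outcomes_measurable S by simp

lemma T_indicator_int:
  "integrable M f \<Longrightarrow> integrable M (\<lambda>\<omega>. indicator {\<omega> \<in> space M. T \<omega> \<in> A} \<omega> * f \<omega> :: real)"
  using integrable_mult_indicator[OF T_event, of f A] by simp

text \<open>\<open>Y\<close> switches between finitely many potential outcomes, so its integrability
  follows from theirs.\<close>

lemma
  shows Y_eq_sum: "\<omega> \<in> space M \<Longrightarrow> Y \<omega> = (\<Sum>t\<le>n. indicator {\<omega> \<in> space M. T \<omega> \<in> {t}} \<omega> * Yp t \<omega>)"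
    and Y_int: "integrable M Y"
proof -
  show *: "Y \<omega> = (\<Sum>t\<le>n. indicator {\<omega> \<in> space M. T \<omega> \<in> {t}} \<omega> * Yp t \<omega>)" if "\<omega> \<in> space M" for \<omega>
  proof -
    have "(\<Sum>t\<le>n. indicator {\<omega> \<in> space M. T \<omega> \<in> {t}} \<omega> * Yp t \<omega>)
        = (\<Sum>t\<le>n. if t = T \<omega> then Yp (T \<omega>) \<omega> else 0)"
      using that by (intro sum.cong) auto
    moreover have "T \<omega> \<le> n" using measurable_space[OF T that] by simp
    ultimately show ?thesis using that by (simp add: Y_eq)
  qed
  have "integrable M (\<lambda>\<omega>. \<Sum>t\<le>n. indicator {\<omega> \<in> space M. T \<omega> \<in> {t}} \<omega> * Yp t \<omega>)"
    by (intro Bochner_Integration.integrable_sum T_indicator_int Yp_int) simp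
  then show "integrable M Y"
    by (subst Bochner_Integration.integrable_cong[OF refl *])
qed

lemma \<beta>_int: "integrable M (\<lambda>\<omega>. \<beta> \<omega> $ k)"
  unfolding effects_def using Yp_int hi lo by simp

text \<open>Solving the outcome decomposition for the intercept leaves \<open>Y\<close> minus
  effects multiplied by bounded indicators.\<close>

lemma \<alpha>_int: "integrable M (\<lambda>\<omega>. \<alpha> (potential_outcomes n Yp \<omega>))"
proof -
  have "integrable M (\<lambda>\<omega>. Y \<omega> - (\<Sum>k\<in>UNIV. indicator {\<omega> \<in> space M. T \<omega> \<in> R k} \<omega> * \<beta> \<omega> $ k))"
    by (intro Bochner_Integration.integrable_diff Bochner_Integration.integrable_sum
        T_indicator_int Y_int \<beta>_int)
  moreover have "\<alpha> (potential_outcomes n Yp \<omega>)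
      = Y \<omega> - (\<Sum>k\<in>UNIV. indicator {\<omega> \<in> space M. T \<omega> \<in> R k} \<omega> * \<beta> \<omega> $ k)" if "\<omega> \<in> space M" for \<omega>
    using Y_decomp[OF that] that by (simp add: indicators_def indicator_def)
  ultimately show ?thesis
    by (subst Bochner_Integration.integrable_cong[OF refl])
qed

section \<open>Demeaning and the conditional law on an atom\<close>

lemma demean_at:
  assumes "integrable M f" "x \<in> atoms" "\<omega> \<in> atom x"
  shows "demean M X f \<omega> = f \<omega> - (\<integral>\<omega>'. f \<omega>' \<partial>given M X x)"
  using real_cond_exp_on_atom[OF X _ assms(1), of x \<omega>] assms
  by (simp add: demean_def given_def)

lemma demean_borel: "f \<in> borel_measurable M \<Longrightarrow> demean M X f \<in> borel_measurable M"
  unfolding demean_def by simp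

lemma
  assumes "integrable M f"
  shows demean_int: "integrable M (demean M X f)" and demean_mean: "integral\<^sup>L M (demean M X f) = 0"
proof -
  interpret F: sigma_finite_subalgebra M "vimage_algebra (space M) X borel"
    using X by (rule sigma_finite_subalgebra_vimage)
  show "integrable M (demean M X f)" "integral\<^sup>L M (demean M X f) = 0"
    unfolding demean_def using assms by (auto simp: F.real_cond_exp_int)
qed

lemma prob_space_given: "x \<in> atoms \<Longrightarrow> prob_space (given M X x)"
  unfolding given_def by (intro prob_space_uniform_measure) (auto simp: emeasure_eq_measure)

lemma space_given: "space (given M X x) = space M"
  by (simp add: given_def)

lemma sets_given: "sets (given M X x) = sets M"
  by (simp add: given_def)

lemma measurable_given: "measurable (given M X x) N = measurable M N"
  by (rule measurable_cong_sets) (simp_all add: given_def)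

lemma AE_given: "AE \<omega> in given M X x. \<omega> \<in> atom x"
  unfolding given_def by (rule AE_uniform_measureI) auto

lemma integrable_given: "integrable M f \<Longrightarrow> integrable (given M X x) (f :: 'w \<Rightarrow> real)"
  unfolding given_def by (rule integrable_uniform_measure) auto

lemma integrable_if_given:
  "f \<in> borel_measurable M \<Longrightarrow> (\<And>x. x \<in> atoms \<Longrightarrow> integrable (given M X x) f) \<Longrightarrow>
    integrable M (f :: 'w \<Rightarrow> real)"
  by (rule integrable_if_integrable_on_atoms[OF finite_atoms AE_atoms X])
    (auto simp: given_def)

text \<open>On an atom demeaning subtracts a constant, so the square is a quadratic polynomial in
  the instrument; integrability is then assembled from the finitely many atoms.\<close>

lemma demean_sq: "integrable M (\<lambda>\<omega>. (demean M X (\<lambda>\<omega>. Z \<omega> $ i) \<omega>)\<^sup>2)"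
proof (rule integrable_if_given)
  fix x assume x: "x \<in> atoms"
  interpret Q: prob_space "given M X x" using x by (rule prob_space_given)
  let ?c = "\<integral>\<omega>'. Z \<omega>' $ i \<partial>given M X x"
  have "integrable (given M X x) (\<lambda>\<omega>. (Z \<omega> $ i - ?c)\<^sup>2)"
    using integrable_given[OF Z_sq, of x i] integrable_given[OF Z_int, of x i]
    by (simp add: power2_diff)
  moreover have "(\<lambda>\<omega>. (demean M X (\<lambda>\<omega>. Z \<omega> $ i) \<omega>)\<^sup>2) \<in> borel_measurable (given M X x)"
    unfolding measurable_given by (intro borel_measurable_power demean_borel Z_nth_borel)
  moreover have "AE \<omega> in given M X x. (Z \<omega> $ i - ?c)\<^sup>2 = (demean M X (\<lambda>\<omega>. Z \<omega> $ i) \<omega>)\<^sup>2"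
    using AE_given by eventually_elim (simp add: demean_at[OF Z_int x])
  ultimately show "integrable (given M X x) (\<lambda>\<omega>. (demean M X (\<lambda>\<omega>. Z \<omega> $ i) \<omega>)\<^sup>2)"
    by (rule integrable_cong_AE_imp)
qed (intro borel_measurable_power demean_borel Z_nth_borel)

section \<open>Factorization under exogeneity and projections on the instrument\<close>

text \<open>Independence makes a product of merely integrable factors integrable. This is why first
  moments of the potential outcomes suffice.\<close>

lemma
  fixes G :: "_ \<Rightarrow> real" and H :: "_ \<Rightarrow> real"
  assumes x: "x \<in> atoms"
    and G: "G \<in> borel_measurable potential" and H: "H \<in> borel_measurable (restrict_space borel \<Z>)"
    and Gi: "integrable (given M X x) (\<lambda>\<omega>. G (pot \<omega>))"
    and Hi: "integrable (given M X x) (\<lambda>\<omega>. H (Z \<omega>))"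
  shows integrable_given_mult: "integrable (given M X x) (\<lambda>\<omega>. G (pot \<omega>) * H (Z \<omega>))"
    and integral_given_mult: "(\<integral>\<omega>. G (pot \<omega>) * H (Z \<omega>) \<partial>given M X x)
      = (\<integral>\<omega>. G (pot \<omega>) \<partial>given M X x) * (\<integral>\<omega>. H (Z \<omega>) \<partial>given M X x)"
proof -
  interpret Q: prob_space "given M X x" using x by (rule prob_space_given)
  have iv: "Q.indep_var borel (\<lambda>\<omega>. G (pot \<omega>)) borel (\<lambda>\<omega>. H (Z \<omega>))"
    using x by (intro cond_indep_discrete_imp_indep_var[OF exogeneity pot_measurable Z G H]) simp
  show "integrable (given M X x) (\<lambda>\<omega>. G (pot \<omega>) * H (Z \<omega>))"
    by (rule Q.indep_var_integrable[OF iv Gi Hi])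
  show "(\<integral>\<omega>. G (pot \<omega>) * H (Z \<omega>) \<partial>given M X x)
      = (\<integral>\<omega>. G (pot \<omega>) \<partial>given M X x) * (\<integral>\<omega>. H (Z \<omega>) \<partial>given M X x)"
    by (rule Q.indep_var_lebesgue_integral[OF iv Gi Hi])
qed

text \<open>
  The value of the projection on \<open>{X = x}\<close> as a function of the instrument alone, so that independence
  of \<open>Z\<close> from the potential outcomes given \<open>X = x\<close> applies to it.
\<close>

definition proj_at :: "real^'m^'p \<Rightarrow> real^'q \<Rightarrow> 'p \<Rightarrow> real^'m \<Rightarrow> real" where
  "proj_at L x i z = (\<Sum>j\<in>UNIV. L $ i $ j * (z $ j - (\<integral>\<omega>. Z \<omega> $ j \<partial>given M X x)))"

text \<open>The matrix stays a parameter, since the identities below hold for any linear image of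
  the demeaned instruments; the theorem takes the projection coefficients for
  \<open>L\<close>.\<close>

abbreviation "proj L \<omega> \<equiv> L *v demean_vec M X Z \<omega>"

lemma proj_nth: "proj L \<omega> $ i = (\<Sum>j\<in>UNIV. L $ i $ j * demean M X (\<lambda>\<omega>. Z \<omega> $ j) \<omega>)"
  by (simp add: matrix_vector_mult_def demean_vec_def)

lemma proj_borel: "(\<lambda>\<omega>. proj L \<omega> $ i) \<in> borel_measurable M"
  unfolding proj_nth
  by (intro borel_measurable_sum borel_measurable_times borel_measurable_const demean_borel Z_nth_borel)

lemma proj_mean: "(\<integral>\<omega>. proj L \<omega> $ i \<partial>M) = 0"
  unfolding proj_nth
  by (subst Bochner_Integration.integral_sum) (simp_all add: demean_int demean_mean Z_int)

lemma proj_eq_proj_at: "x \<in> atoms \<Longrightarrow> \<omega> \<in> atom x \<Longrightarrow> proj L \<omega> $ i = proj_at L x i (Z \<omega>)"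
  unfolding proj_nth proj_at_def by (simp add: demean_at[OF Z_int])

lemma proj_at_borel: "proj_at L x i \<in> borel_measurable (restrict_space borel \<Z>)"
proof -
  have "(\<lambda>z::real^'m. z $ j) \<in> borel_measurable borel" for j
    by (intro borel_measurable_continuous_onI continuous_on_component continuous_on_id)
  then have "proj_at L x i \<in> borel_measurable borel"
    unfolding proj_at_def by simp
  then show ?thesis by (rule measurable_restrict_space1)
qed

lemma proj_at_int: "x \<in> atoms \<Longrightarrow> integrable (given M X x) (\<lambda>\<omega>. proj_at L x i (Z \<omega>))"
proof -
  assume "x \<in> atoms"
  then interpret Q: prob_space "given M X x" by (rule prob_space_given)
  show ?thesis
    unfolding proj_at_def using integrable_given[OF Z_int] by simp
qed

lemma proj_at_mean: "x \<in> atoms \<Longrightarrow> (\<integral>\<omega>. proj_at L x i (Z \<omega>) \<partial>given M X x) = 0"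
proof -
  assume "x \<in> atoms"
  then interpret Q: prob_space "given M X x" by (rule prob_space_given)
  show ?thesis
    unfolding proj_at_def using integrable_given[OF Z_int, of x]
    by (subst Bochner_Integration.integral_sum) (simp_all add: Q.prob_space)
qed

lemma indicators_borel:
  "s \<in> types \<Longrightarrow> (\<lambda>z. indicators R (s z) $ k) \<in> borel_measurable (restrict_space borel \<Z>)"
  unfolding response_types_def indicators_def
  by (auto intro: measurable_compose[of s _ "count_space {..n}"])

lemma indicators_bound: "\<bar>indicators R t $ k\<bar> \<le> 1"
  by (simp add: indicators_def indicator_def)

lemma abs_mult_indicators_le: "\<bar>a * indicators R t $ k\<bar> \<le> \<bar>a\<bar>"
  using mult_left_mono[OF indicators_bound, of "\<bar>a\<bar>"] by (simp add: abs_mult)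

lemma proj_at_indicators_int:
  assumes "x \<in> atoms" "s \<in> types"
  shows "integrable (given M X x) (\<lambda>\<omega>. proj_at L x i (Z \<omega>) * indicators R (s (Z \<omega>)) $ k)"
proof (rule Bochner_Integration.integrable_bound[OF proj_at_int[OF assms(1)]])
  have "(\<lambda>\<omega>. proj_at L x i (Z \<omega>)) \<in> borel_measurable M"
    "(\<lambda>\<omega>. indicators R (s (Z \<omega>)) $ k) \<in> borel_measurable M"
    using measurable_compose[OF Z proj_at_borel] measurable_compose[OF Z indicators_borel[OF assms(2)]]
    by auto
  then show "(\<lambda>\<omega>. proj_at L x i (Z \<omega>) * indicators R (s (Z \<omega>)) $ k) \<in> borel_measurable (given M X x)"
    unfolding measurable_given by (rule borel_measurable_times)
  show "AE \<omega> in given M X x.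
      norm (proj_at L x i (Z \<omega>) * indicators R (s (Z \<omega>)) $ k) \<le> norm (proj_at L x i (Z \<omega>))"
    by (simp add: abs_mult_indicators_le)
qed

lemma integral_given_proj:
  assumes x: "x \<in> atoms" and f: "f \<in> borel_measurable M"
  shows "(\<integral>\<omega>. proj L \<omega> $ i * f \<omega> \<partial>given M X x) = (\<integral>\<omega>. proj_at L x i (Z \<omega>) * f \<omega> \<partial>given M X x)"
proof (rule integral_cong_AE)
  show "(\<lambda>\<omega>. proj L \<omega> $ i * f \<omega>) \<in> borel_measurable (given M X x)"
    unfolding measurable_given by (intro borel_measurable_times proj_borel f)
  show "(\<lambda>\<omega>. proj_at L x i (Z \<omega>) * f \<omega>) \<in> borel_measurable (given M X x)"
    unfolding measurable_given
    by (intro borel_measurable_times measurable_compose[OF Z proj_at_borel] f)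
  show "AE \<omega> in given M X x. proj L \<omega> $ i * f \<omega> = proj_at L x i (Z \<omega>) * f \<omega>"
    using AE_given by eventually_elim (simp only: proj_eq_proj_at[OF x])
qed

text \<open>The projection has mean zero given \<open>X = x\<close>, so centring the indicator
  changes nothing and the covariance is a plain product moment.\<close>

lemma cov_given_proj:
  assumes x: "x \<in> atoms" and s: "s \<in> types"
  shows "cov (given M X x) (\<lambda>\<omega>. proj L \<omega> $ i) (\<lambda>\<omega>. indicators R (s (Z \<omega>)) $ k)
    = (\<integral>\<omega>. proj_at L x i (Z \<omega>) * indicators R (s (Z \<omega>)) $ k \<partial>given M X x)"
proof -
  let ?c = "\<integral>\<omega>. indicators R (s (Z \<omega>)) $ k \<partial>given M X x"
  interpret Q: prob_space "given M X x" using x by (rule prob_space_given)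
  have "(\<integral>\<omega>. proj L \<omega> $ i \<partial>given M X x) = 0"
    using integral_given_proj[OF x, of "\<lambda>_. 1" L i] proj_at_mean[OF x] by simp
  then have "cov (given M X x) (\<lambda>\<omega>. proj L \<omega> $ i) (\<lambda>\<omega>. indicators R (s (Z \<omega>)) $ k)
      = (\<integral>\<omega>. proj L \<omega> $ i * (indicators R (s (Z \<omega>)) $ k - ?c) \<partial>given M X x)"
    by (simp add: cov_def)
  also have "\<dots> = (\<integral>\<omega>. proj_at L x i (Z \<omega>) * (indicators R (s (Z \<omega>)) $ k - ?c) \<partial>given M X x)"
    by (intro integral_given_proj x borel_measurable_diff borel_measurable_const
        measurable_compose[OF Z indicators_borel[OF s]])
  also have "\<dots> = (\<integral>\<omega>. proj_at L x i (Z \<omega>) * indicators R (s (Z \<omega>)) $ k \<partial>given M X x)"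
    unfolding right_diff_distrib
    using proj_at_int[OF x, of L i] proj_at_indicators_int[OF x s, of L i k] proj_at_mean[OF x, of L i]
    by simp
  finally show ?thesis .
qed

lemma Yp_component_borel:
  assumes "t \<le> n"
  shows "(\<lambda>p. fst p t) \<in> borel_measurable potential"
  by (rule measurable_compose[OF measurable_fst]) (use assms in simp)

lemma type_indicator_borel: "(\<lambda>p. indicator {s} (snd p) :: real) \<in> borel_measurable potential"
  by (rule measurable_compose[OF measurable_snd]) simp

text \<open>\<open>Y\<close> depends on the instrument through \<open>T\<close>, so independence
  does not apply to it directly. Splitting by treatment level leaves products of \<open>Yp t\<close>
  with the projection, integrable by independence, times bounded indicators of
  \<open>T\<close>.\<close>

lemma proj_outcome_int: "integrable M (\<lambda>\<omega>. proj L \<omega> $ i * demean M X Y \<omega>)"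
proof (rule integrable_if_given)
  have meas: "(\<lambda>\<omega>. proj L \<omega> $ i * demean M X Y \<omega>) \<in> borel_measurable M"
    by (intro borel_measurable_times proj_borel demean_borel borel_measurable_integrable[OF Y_int])
  then show "(\<lambda>\<omega>. proj L \<omega> $ i * demean M X Y \<omega>) \<in> borel_measurable M" .
  fix x assume x: "x \<in> atoms"
  interpret Q: prob_space "given M X x" using x by (rule prob_space_given)
  let ?q = "\<lambda>\<omega>. proj_at L x i (Z \<omega>)"
  let ?c = "\<integral>\<omega>. Y \<omega> \<partial>given M X x"
  have "integrable (given M X x) (\<lambda>\<omega>. indicator {\<omega> \<in> space M. T \<omega> \<in> {t}} \<omega> *\<^sub>R (Yp t \<omega> * ?q \<omega>))"
    if "t \<le> n" for t
  proof (rule integrable_mult_indicator)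
    show "{\<omega> \<in> space M. T \<omega> \<in> {t}} \<in> sets (given M X x)"
      unfolding sets_given by (rule T_event)
    have Yp_eq: "fst (pot \<omega>) t = Yp t \<omega>" for \<omega>
      using that by (simp add: potential_outcomes_def)
    show "integrable (given M X x) (\<lambda>\<omega>. Yp t \<omega> * ?q \<omega>)"
      using integrable_given_mult[OF x Yp_component_borel[OF that] proj_at_borel _ proj_at_int[OF x]]
        integrable_given[OF Yp_int[OF that]] unfolding Yp_eq by blast
  qed
  then have "integrable (given M X x)
      (\<lambda>\<omega>. (\<Sum>t\<le>n. indicator {\<omega> \<in> space M. T \<omega> \<in> {t}} \<omega> *\<^sub>R (Yp t \<omega> * ?q \<omega>)) - ?q \<omega> * ?c)"
    using proj_at_int[OF x]
    by (intro Bochner_Integration.integrable_diff Bochner_Integration.integrable_sum) auto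
  moreover have "(\<lambda>\<omega>. proj L \<omega> $ i * demean M X Y \<omega>) \<in> borel_measurable (given M X x)"
    unfolding measurable_given by (rule meas)
  moreover have "AE \<omega> in given M X x.
      (\<Sum>t\<le>n. indicator {\<omega> \<in> space M. T \<omega> \<in> {t}} \<omega> *\<^sub>R (Yp t \<omega> * ?q \<omega>)) - ?q \<omega> * ?c
      = proj L \<omega> $ i * demean M X Y \<omega>"
    using AE_given
  proof eventually_elim
    case (elim \<omega>)
    then have "\<omega> \<in> space M" by simp
    have "(\<Sum>t\<le>n. indicator {\<omega> \<in> space M. T \<omega> \<in> {t}} \<omega> *\<^sub>R (Yp t \<omega> * ?q \<omega>)) = Y \<omega> * ?q \<omega>"
      unfolding Y_eq_sum[OF \<open>\<omega> \<in> space M\<close>] sum_distrib_right by (simp add: mult.assoc)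
    then show ?case
      unfolding proj_eq_proj_at[OF x elim] demean_at[OF Y_int x elim]
      by (simp only: algebra_simps)
  qed
  ultimately show "integrable (given M X x) (\<lambda>\<omega>. proj L \<omega> $ i * demean M X Y \<omega>)"
    by (rule integrable_cong_AE_imp)
qed

section \<open>Mean effects by type and control value\<close>

lemma joint_event: "{\<omega> \<in> space M. S \<omega> = s \<and> X \<omega> = x} \<in> events"
proof (cases "s \<in> types")
  case True
  have "{\<omega> \<in> space M. S \<omega> = s \<and> X \<omega> = x} = type_is s \<inter> atom x" by auto
  then show ?thesis using type_is_event[OF True] atom_event[of x] by simp
next
  case False
  then have "{\<omega> \<in> space M. S \<omega> = s \<and> X \<omega> = x} = {}"
    using measurable_space[OF S] by auto
  then show ?thesis by (simp only: sets.empty_sets)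
qed

lemma mean_effect_nth: "mean_effect M S X \<beta> s x $ k
    = (\<integral>\<omega>. \<beta> \<omega> $ k \<partial>uniform_measure M {\<omega> \<in> space M. S \<omega> = s \<and> X \<omega> = x})"
  unfolding mean_effect_def
  by (intro integral_vec_nth integrable_uniform_measure joint_event \<beta>_int)

text \<open>The conditioning event is null here and the integral takes its default value
  \<open>0\<close>. This supplies the vanishing hypothesis of
  \<open>borel_measurable_finite_atoms\<close>.\<close>

lemma mean_effect_off_atoms:
  assumes "x \<notin> atoms"
  shows "mean_effect M S X \<beta> s x $ k = 0"
proof -
  have "prob {\<omega> \<in> space M. S \<omega> = s \<and> X \<omega> = x} \<le> prob (atom x)"
    by (intro finite_measure_mono atom_event) auto
  then have "prob {\<omega> \<in> space M. S \<omega> = s \<and> X \<omega> = x} = 0"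
    using assms measure_nonneg[of M] by (simp add: order_antisym)
  then show ?thesis
    unfolding mean_effect_nth
    by (subst integral_uniform_measure[OF joint_event borel_measurable_integrable[OF \<beta>_int]]) simp
qed

lemma mean_effect_borel: "(\<lambda>\<omega>. mean_effect M S X \<beta> (S \<omega>) (X \<omega>) $ k) \<in> borel_measurable M"
  by (rule borel_measurable_finite_atoms[OF finite_atoms S X]) (auto simp: mean_effect_off_atoms)

text \<open>Evaluated at the realized type and controls, the mean effect is a version of the
  conditional expectation of an integrable effect given \<open>(S, X)\<close>.\<close>

lemma mean_effect_int: "integrable M (\<lambda>\<omega>. mean_effect M S X \<beta> (S \<omega>) (X \<omega>) $ k)"
proof (rule integrable_cong_AE_imp)
  interpret F: sigma_finite_subalgebra M
    "vimage_algebra (space M) (\<lambda>\<omega>. (S \<omega>, X \<omega>)) (count_space types \<Otimes>\<^sub>M borel)"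
    using SX_measurable by (rule sigma_finite_subalgebra_vimage)
  show "integrable M (real_cond_exp M
      (vimage_algebra (space M) (\<lambda>\<omega>. (S \<omega>, X \<omega>)) (count_space types \<Otimes>\<^sub>M borel)) (\<lambda>\<omega>. \<beta> \<omega> $ k))"
    using \<beta>_int by (rule F.real_cond_exp_int)
  show "AE \<omega> in M. real_cond_exp M
      (vimage_algebra (space M) (\<lambda>\<omega>. (S \<omega>, X \<omega>)) (count_space types \<Otimes>\<^sub>M borel)) (\<lambda>\<omega>. \<beta> \<omega> $ k) \<omega>
      = mean_effect M S X \<beta> (S \<omega>) (X \<omega>) $ k"
    using AE_real_cond_exp_atomic[OF SX_measurable SX_sing AE_joint_atoms \<beta>_int, of k]
    by (simp add: mean_effect_nth)
qed (rule mean_effect_borel)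

text \<open>Fixing the type splits the demeaned outcome times the projection into products of a
  function of \<open>pot\<close> and a function of \<open>Z\<close>, to which the factorization
  applies.\<close>

lemma integral_proj_outcome_on_type:
  assumes x: "x \<in> atoms" and s: "s \<in> types"
  shows "(\<integral>\<omega>. indicator (type_is s) \<omega> * (proj L \<omega> $ i * demean M X Y \<omega>) \<partial>given M X x)
    = (\<Sum>k\<in>UNIV. cov (given M X x) (\<lambda>\<omega>. proj L \<omega> $ i) (\<lambda>\<omega>. indicators R (s (Z \<omega>)) $ k)
        * (\<integral>\<omega>. indicator (type_is s) \<omega> * \<beta> \<omega> $ k \<partial>given M X x))"
proof -
  interpret Q: prob_space "given M X x" using x by (rule prob_space_given)
  let ?c = "\<integral>\<omega>. Y \<omega> \<partial>given M X x"
  let ?q = "proj_at L x i"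
  let ?q' = "\<lambda>k z. ?q z * indicators R (s z) $ k"
  \<comment> \<open>\<open>?G\<close> and \<open>?G'\<close> collect what depends on the potential
    outcomes and the type, \<open>?q\<close> and \<open>?q'\<close> what depends on the instrument.
    The response \<open>s\<close> is fixed, so its value at \<open>Z\<close> belongs to the second
    group.\<close>
  let ?G = "\<lambda>p :: (nat \<Rightarrow> real) \<times> (real^'m \<Rightarrow> nat). indicator {s} (snd p) * (\<alpha> (fst p) - ?c)"
  let ?G' = "\<lambda>k (p :: (nat \<Rightarrow> real) \<times> (real^'m \<Rightarrow> nat)).
    indicator {s} (snd p) * (fst p (hi k) - fst p (lo k))"
  have G_borel: "?G \<in> borel_measurable potential"
    by (intro borel_measurable_times borel_measurable_diff type_indicator_borel
        measurable_compose[OF measurable_fst \<alpha>] borel_measurable_const)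
  have G'_borel: "?G' k \<in> borel_measurable potential" for k
    by (intro borel_measurable_times borel_measurable_diff type_indicator_borel
        Yp_component_borel hi lo)
  have q'_borel: "?q' k \<in> borel_measurable (restrict_space borel \<Z>)" for k
    by (intro borel_measurable_times proj_at_borel indicators_borel s)
  have type_int: "integrable (given M X x) (\<lambda>\<omega>. indicator (type_is s) \<omega> * f \<omega>)"
    if "integrable M f" for f :: "'w \<Rightarrow> real"
    using integrable_given[OF integrable_mult_indicator[OF type_is_event[OF s] that]] by simp
  have G_eq: "?G (pot \<omega>) = indicator (type_is s) \<omega> * (\<alpha> (potential_outcomes n Yp \<omega>) - ?c)"
    if "\<omega> \<in> space M" for \<omega>
    using that by (simp add: indicator_def)
  have G'_eq: "?G' k (pot \<omega>) = indicator (type_is s) \<omega> * \<beta> \<omega> $ k" if "\<omega> \<in> space M" for k \<omega>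
    using that hi lo by (simp add: indicator_def effects_def potential_outcomes_def)
  have G_int: "integrable (given M X x) (\<lambda>\<omega>. ?G (pot \<omega>))"
    using type_int[of "\<lambda>\<omega>. \<alpha> (potential_outcomes n Yp \<omega>) - ?c"] \<alpha>_int
    by (subst Bochner_Integration.integrable_cong[OF refl G_eq]) (simp_all add: space_given)
  have G'_int: "integrable (given M X x) (\<lambda>\<omega>. ?G' k (pot \<omega>))" for k
    using type_int[OF \<beta>_int]
    by (subst Bochner_Integration.integrable_cong[OF refl G'_eq]) (simp_all add: space_given)
  have int_G': "(\<integral>\<omega>. ?G' k (pot \<omega>) \<partial>given M X x)
      = (\<integral>\<omega>. indicator (type_is s) \<omega> * \<beta> \<omega> $ k \<partial>given M X x)" for k
    by (intro Bochner_Integration.integral_cong refl G'_eq) (simp add: space_given)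
  have q'_int: "integrable (given M X x) (\<lambda>\<omega>. ?q' k (Z \<omega>))" for k
    by (rule proj_at_indicators_int[OF x s])
  have "(\<integral>\<omega>. indicator (type_is s) \<omega> * (proj L \<omega> $ i * demean M X Y \<omega>) \<partial>given M X x)
      = (\<integral>\<omega>. ?G (pot \<omega>) * ?q (Z \<omega>) + (\<Sum>k\<in>UNIV. ?G' k (pot \<omega>) * ?q' k (Z \<omega>)) \<partial>given M X x)"
  proof (rule integral_cong_AE)
    show "(\<lambda>\<omega>. indicator (type_is s) \<omega> * (proj L \<omega> $ i * demean M X Y \<omega>)) \<in> borel_measurable (given M X x)"
      unfolding measurable_given
      by (intro borel_measurable_times borel_measurable_indicator type_is_event s proj_borel
          demean_borel borel_measurable_integrable[OF Y_int])
    show "(\<lambda>\<omega>. ?G (pot \<omega>) * ?q (Z \<omega>) + (\<Sum>k\<in>UNIV. ?G' k (pot \<omega>) * ?q' k (Z \<omega>)))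
        \<in> borel_measurable (given M X x)"
      unfolding measurable_given
      by (rule borel_measurable_add[OF
            borel_measurable_times[OF measurable_compose[OF pot_measurable G_borel]
              measurable_compose[OF Z proj_at_borel]]
            borel_measurable_sum[OF borel_measurable_times[OF
                measurable_compose[OF pot_measurable G'_borel] measurable_compose[OF Z q'_borel]]]])
    show "AE \<omega> in given M X x. indicator (type_is s) \<omega> * (proj L \<omega> $ i * demean M X Y \<omega>)
        = ?G (pot \<omega>) * ?q (Z \<omega>) + (\<Sum>k\<in>UNIV. ?G' k (pot \<omega>) * ?q' k (Z \<omega>))"
      using AE_given
    proof eventually_elim
      case (elim \<omega>)
      then have \<omega>: "\<omega> \<in> space M" by simp
      show ?case
      proof (cases "S \<omega> = s")
        case True
        \<comment> \<open>The realized treatment is now a function of the instrument alone, which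
          turns the treatment indicators into the factors of \<open>?q'\<close>.\<close>
        then have "T \<omega> = s (Z \<omega>)" using T_eq[OF \<omega>] by simp
        then show ?thesis
          using \<omega> True
          unfolding G_eq[OF \<omega>] G'_eq[OF \<omega>] proj_eq_proj_at[OF x elim] demean_at[OF Y_int x elim]
            Y_decomp[OF \<omega>]
          by (simp add: ring_distribs sum_distrib_left mult.commute mult.left_commute)
      next
        case False
        then show ?thesis
          unfolding G_eq[OF \<omega>] G'_eq[OF \<omega>] by simp
      qed
    qed
  qed
  also have "\<dots> = (\<integral>\<omega>. ?G (pot \<omega>) * ?q (Z \<omega>) \<partial>given M X x)
      + (\<Sum>k\<in>UNIV. \<integral>\<omega>. ?G' k (pot \<omega>) * ?q' k (Z \<omega>) \<partial>given M X x)"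
  proof (subst Bochner_Integration.integral_add)
    note int = integrable_given_mult[OF x G'_borel q'_borel G'_int q'_int]
    show "integrable (given M X x) (\<lambda>\<omega>. \<Sum>k\<in>UNIV. ?G' k (pot \<omega>) * ?q' k (Z \<omega>))"
      by (intro Bochner_Integration.integrable_sum int)
    show "(\<integral>\<omega>. ?G (pot \<omega>) * ?q (Z \<omega>) \<partial>given M X x)
        + (\<integral>\<omega>. (\<Sum>k\<in>UNIV. ?G' k (pot \<omega>) * ?q' k (Z \<omega>)) \<partial>given M X x)
      = (\<integral>\<omega>. ?G (pot \<omega>) * ?q (Z \<omega>) \<partial>given M X x)
        + (\<Sum>k\<in>UNIV. \<integral>\<omega>. ?G' k (pot \<omega>) * ?q' k (Z \<omega>) \<partial>given M X x)"
      by (subst Bochner_Integration.integral_sum[OF int]) (rule refl)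
  qed (rule integrable_given_mult[OF x G_borel proj_at_borel G_int proj_at_int[OF x]])
  \<comment> \<open>After factoring, the \<open>?G\<close> term carries the conditional mean of
    \<open>?q\<close>, which is zero; this disposes of \<open>\<alpha>\<close> and \<open>?c\<close>
    together.\<close>
  also have "\<dots> = (\<Sum>k\<in>UNIV. (\<integral>\<omega>. ?G' k (pot \<omega>) \<partial>given M X x) * (\<integral>\<omega>. ?q' k (Z \<omega>) \<partial>given M X x))"
    unfolding integral_given_mult[OF x G_borel proj_at_borel G_int proj_at_int[OF x]]
      integral_given_mult[OF x G'_borel q'_borel G'_int q'_int] proj_at_mean[OF x]
    by simp
  finally show ?thesis
    unfolding int_G' cov_given_proj[OF x s] by (simp only: mult.commute)
qed

section \<open>Weighted effects and the covariance with the outcome\<close>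

text \<open>The weighted effect before multiplication by the inverse variance of the projection, a
  constant matrix that is restored only in the theorem.\<close>

abbreviation weighted_effect :: "real^'m^'n \<Rightarrow> 'w \<Rightarrow> real^'n" where
  "weighted_effect L \<omega> \<equiv> Cov (given M X (X \<omega>)) (proj L) (\<lambda>\<omega>'. indicators R (S \<omega> (Z \<omega>')))
    *v mean_effect M S X \<beta> (S \<omega>) (X \<omega>)"

lemma weighted_effect_nth: "weighted_effect L \<omega> $ i = (\<Sum>k\<in>UNIV.
    cov (given M X (X \<omega>)) (\<lambda>\<omega>. proj L \<omega> $ i) (\<lambda>\<omega>'. indicators R (S \<omega> (Z \<omega>')) $ k)
    * mean_effect M S X \<beta> (S \<omega>) (X \<omega>) $ k)"
  by (simp add: matrix_vector_mult_def Cov_def)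

text \<open>The indicators are at most \<open>1\<close>, so the covariances are bounded by absolute
  moments of the projection that do not involve the type. Summing over the finitely many atoms
  bounds all weights at once, even for infinitely many types, and the mean effect dominates.\<close>

lemma weighted_effect_int: "integrable M (\<lambda>\<omega>. weighted_effect L \<omega> $ i)"
  unfolding weighted_effect_nth
proof (rule Bochner_Integration.integrable_sum)
  fix k
  let ?w = "\<lambda>s x. cov (given M X x) (\<lambda>\<omega>. proj L \<omega> $ i) (\<lambda>\<omega>. indicators R (s (Z \<omega>)) $ k)"
  let ?b = "\<lambda>s x. mean_effect M S X \<beta> s x $ k"
  let ?B = "\<lambda>x. \<integral>\<omega>. \<bar>proj_at L x i (Z \<omega>)\<bar> \<partial>given M X x"
  have w_le: "\<bar>?w s x\<bar> \<le> (\<Sum>x\<in>atoms. ?B x)" if "x \<in> atoms" "s \<in> types" for s x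
  proof -
    have "\<bar>?w s x\<bar> \<le> (\<integral>\<omega>. \<bar>proj_at L x i (Z \<omega>) * indicators R (s (Z \<omega>)) $ k\<bar> \<partial>given M X x)"
      unfolding cov_given_proj[OF that] by (rule integral_abs_bound)
    also have "\<dots> \<le> ?B x"
      by (intro integral_mono integrable_abs abs_mult_indicators_le proj_at_int
          proj_at_indicators_int that)
    also have "\<dots> \<le> (\<Sum>x\<in>atoms. ?B x)"
      using finite_atoms that(1) by (intro member_le_sum) auto
    finally show ?thesis .
  qed
  show "integrable M (\<lambda>\<omega>. ?w (S \<omega>) (X \<omega>) * ?b (S \<omega>) (X \<omega>))"
  proof (rule Bochner_Integration.integrable_bound)
    show "integrable M (\<lambda>\<omega>. (\<Sum>x\<in>atoms. ?B x) * ?b (S \<omega>) (X \<omega>))"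
      by (intro integrable_mult_right mean_effect_int)
    show "(\<lambda>\<omega>. ?w (S \<omega>) (X \<omega>) * ?b (S \<omega>) (X \<omega>)) \<in> borel_measurable M"
      by (rule borel_measurable_finite_atoms[OF finite_atoms S X]) (auto simp: mean_effect_off_atoms)
    show "AE \<omega> in M. norm (?w (S \<omega>) (X \<omega>) * ?b (S \<omega>) (X \<omega>))
        \<le> norm ((\<Sum>x\<in>atoms. ?B x) * ?b (S \<omega>) (X \<omega>))"
      using AE_atoms AE_space
    proof eventually_elim
      case (elim \<omega>)
      have "S \<omega> \<in> types" using measurable_space[OF S elim(2)] by simp
      from w_le[OF elim(1) this] show ?case
        unfolding real_norm_def abs_mult by (intro mult_right_mono) auto
    qed
  qed
qed

lemma cov_proj_outcome:
  "cov M (\<lambda>\<omega>. proj L \<omega> $ i) (demean M X Y) = (\<integral>\<omega>. weighted_effect L \<omega> $ i \<partial>M)"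
proof -
  have "cov M (\<lambda>\<omega>. proj L \<omega> $ i) (demean M X Y) = (\<integral>\<omega>. proj L \<omega> $ i * demean M X Y \<omega> \<partial>M)"
    by (simp add: cov_def proj_mean demean_mean Y_int)
  also have "\<dots> = (\<integral>\<omega>. weighted_effect L \<omega> $ i \<partial>M)"
  proof (rule integral_eq_if_eq_on_atoms[OF SX_measurable _ AE_joint_atoms
        proj_outcome_int weighted_effect_int])
    fix v :: "(real^'m \<Rightarrow> nat) \<times> (real^'q)"
    assume pos: "prob {\<omega> \<in> space M. (S \<omega>, X \<omega>) = v} \<noteq> 0"
    obtain s x where v: "v = (s, x)" by (cases v)
    let ?A = "{\<omega> \<in> space M. (S \<omega>, X \<omega>) = v}"
    have A_joint: "?A = {\<omega> \<in> space M. S \<omega> = s \<and> X \<omega> = x}" unfolding v by auto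
    have A_eq: "?A = atom x \<inter> type_is s" unfolding v by auto
    have "prob ?A \<le> prob (atom x)" unfolding A_eq by (intro finite_measure_mono atom_event) auto
    with pos have x: "x \<in> atoms" by (auto simp: measure_le_0_iff)
    \<comment> \<open>\<open>S\<close> takes values in \<open>types\<close> only, so a nonempty
      event suffices to place \<open>s\<close> there.\<close>
    have "?A \<noteq> {}" using pos by (metis measure_empty)
    then have s: "s \<in> types" using measurable_space[OF S] unfolding v by auto
    have A_ev: "?A \<in> events" unfolding A_joint by (rule joint_event)
    interpret U: prob_space "uniform_measure M ?A"
      using pos by (intro prob_space_uniform_measure) (auto simp: emeasure_eq_measure)
    have U_eq: "(\<integral>\<omega>. f \<omega> \<partial>uniform_measure M ?A)
        = (\<integral>\<omega>. indicator (type_is s) \<omega> * f \<omega> \<partial>given M X x) / measure (given M X x) (type_is s)"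
      if "f \<in> borel_measurable M" for f :: "'w \<Rightarrow> real"
      using integral_uniform_measure_Int[OF atom_event _ type_is_event[OF s] that] x
      unfolding A_eq given_def by auto
    have b_eq: "mean_effect M S X \<beta> s x $ k
        = (\<integral>\<omega>. indicator (type_is s) \<omega> * \<beta> \<omega> $ k \<partial>given M X x) / measure (given M X x) (type_is s)" for k
      unfolding mean_effect_nth A_joint[symmetric]
      by (intro U_eq borel_measurable_integrable[OF \<beta>_int])
    have "(\<integral>\<omega>. proj L \<omega> $ i * demean M X Y \<omega> \<partial>uniform_measure M ?A)
        = (\<integral>\<omega>. indicator (type_is s) \<omega> * (proj L \<omega> $ i * demean M X Y \<omega>) \<partial>given M X x)
          / measure (given M X x) (type_is s)"
      by (intro U_eq borel_measurable_integrable proj_outcome_int)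
    \<comment> \<open>Dividing by the probability of the type given \<open>X = x\<close> turns each
      partial mean of an effect into the mean effect of that type.\<close>
    also have "\<dots> = (\<Sum>k\<in>UNIV. cov (given M X x) (\<lambda>\<omega>. proj L \<omega> $ i)
        (\<lambda>\<omega>. indicators R (s (Z \<omega>)) $ k) * mean_effect M S X \<beta> s x $ k)"
      unfolding integral_proj_outcome_on_type[OF x s] b_eq by (simp add: sum_divide_distrib)
    \<comment> \<open>The sum is a constant and the conditional law a probability measure. On
      \<open>?A\<close> the type and the controls are \<open>s\<close> and \<open>x\<close>, so the
      constant agrees there with the weighted effect.\<close>
    also have "\<dots> = (\<integral>\<omega>. (\<Sum>k\<in>UNIV. cov (given M X x) (\<lambda>\<omega>. proj L \<omega> $ i)
        (\<lambda>\<omega>. indicators R (s (Z \<omega>)) $ k) * mean_effect M S X \<beta> s x $ k) \<partial>uniform_measure M ?A)"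
      using U.prob_space by (simp del: space_uniform_measure)
    also have "\<dots> = (\<integral>\<omega>. weighted_effect L \<omega> $ i \<partial>uniform_measure M ?A)"
    proof (rule integral_cong_AE)
      show "(\<lambda>\<omega>. weighted_effect L \<omega> $ i) \<in> borel_measurable (uniform_measure M ?A)"
        unfolding measurable_cong_sets[OF sets_uniform_measure refl]
        by (rule borel_measurable_integrable[OF weighted_effect_int])
      show "AE \<omega> in uniform_measure M ?A. (\<Sum>k\<in>UNIV. cov (given M X x) (\<lambda>\<omega>. proj L \<omega> $ i)
          (\<lambda>\<omega>. indicators R (s (Z \<omega>)) $ k) * mean_effect M S X \<beta> s x $ k) = weighted_effect L \<omega> $ i"
        unfolding weighted_effect_nth
        by (rule AE_uniform_measureI[OF A_ev], rule AE_I2) (simp add: v)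
    qed simp
    finally show "(\<integral>\<omega>. proj L \<omega> $ i * demean M X Y \<omega> \<partial>uniform_measure M ?A)
        = (\<integral>\<omega>. weighted_effect L \<omega> $ i \<partial>uniform_measure M ?A)" .
  qed (rule SX_sing)
  finally show ?thesis .
qed

lemma Cov_scalar_proj_outcome:
  "Cov_scalar M (proj L) (demean M X Y) = (\<integral>\<omega>. weighted_effect L \<omega> \<partial>M)"
  by (rule vec_eq_iff[THEN iffD2], rule allI)
    (simp only: Cov_scalar_def vec_lambda_beta cov_proj_outcome integral_vec_nth[OF weighted_effect_int])

end

section \<open>The 2SLS estimand as a weighted mean of type-specific effects\<close>

text \<open>\<open>matrix_inv\<close> and the integral are total functions with default values, so
  invertibility and integrability are part of the conclusion: they give both sides of the equation
  their intended meaning.\<close>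

theorem propositionB1:
  fixes M :: "'w measure"
    and \<Z> :: "(real^'m) set"
    and Z :: "'w \<Rightarrow> real^'m"
    and X :: "'w \<Rightarrow> real^'q"
    and S :: "'w \<Rightarrow> real^'m \<Rightarrow> nat"
    and T :: "'w \<Rightarrow> nat"
    and Yp :: "nat \<Rightarrow> 'w \<Rightarrow> real"
    and Y :: "'w \<Rightarrow> real"
    and R :: "'n::finite \<Rightarrow> nat set"
    and hi lo :: "'n \<Rightarrow> nat"
    and \<alpha> :: "(nat \<Rightarrow> real) \<Rightarrow> real"
    and n :: nat
    and \<beta> D Dd P :: "'w \<Rightarrow> real^'n"
    and Zd :: "'w \<Rightarrow> real^'m"
    and Yd :: "'w \<Rightarrow> real"
  defines "n \<equiv> CARD('n)"
    and "\<beta> \<equiv> effects Yp hi lo"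
    and "D \<equiv> (\<lambda>\<omega>. indicators R (T \<omega>))"
    and "Yd \<equiv> demean M X Y"
    and "Dd \<equiv> demean_vec M X D"
    and "Zd \<equiv> demean_vec M X Z"
    and "P \<equiv> lin_proj M Zd Dd"
  assumes "prob_space M"
    and "n \<le> CARD('m)"
    and "Z \<in> M \<rightarrow>\<^sub>M restrict_space borel \<Z>"
    and "X \<in> M \<rightarrow>\<^sub>M borel" and "finite_support M X"
    and "T \<in> M \<rightarrow>\<^sub>M count_space {..n}"
    and "S \<in> M \<rightarrow>\<^sub>M count_space (response_types \<Z> n)"
    and "AE \<omega> in M. S \<omega> \<in> types_at M \<Z> n S X (X \<omega>)"
    and "\<And>t. t \<le> n \<Longrightarrow> Yp t \<in> borel_measurable M"
    and "\<And>\<omega>. \<omega> \<in> space M \<Longrightarrow> T \<omega> = S \<omega> (Z \<omega>)"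
    and "\<And>\<omega>. \<omega> \<in> space M \<Longrightarrow> Y \<omega> = Yp (T \<omega>) \<omega>"
    and "\<And>k. hi k \<le> n" and "\<And>k. lo k \<le> n"
    and "\<And>k. R k \<subseteq> {..n}"
    and "\<alpha> \<in> borel_measurable (PiM {..n} (\<lambda>_. borel))"
    and "\<And>\<omega>. \<omega> \<in> space M \<Longrightarrow>
           Y \<omega> = \<alpha> (potential_outcomes n Yp \<omega>) + (\<Sum>k\<in>UNIV. D \<omega> $ k * \<beta> \<omega> $ k)"
    and "\<And>t. t \<le> n \<Longrightarrow> integrable M (Yp t)"
    and "\<And>i. integrable M (\<lambda>\<omega>. (Z \<omega> $ i)\<^sup>2)"
    and "invertible (Var M Zd)"
    and exogeneity_exclusion:
      "cond_indep_discrete M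
         (PiM {..n} (\<lambda>_. borel) \<Otimes>\<^sub>M count_space (response_types \<Z> n))
         (\<lambda>\<omega>. (potential_outcomes n Yp \<omega>, S \<omega>))
         (restrict_space borel \<Z>) Z X"
    and rank_condition: "rank (Cov M Zd Dd) = n"
  shows "invertible (Var M P) \<and>
     integrable M (\<lambda>\<omega>. weight M Z X R P (S \<omega>) (X \<omega>) *v mean_effect M S X \<beta> (S \<omega>) (X \<omega>)) \<and>
     tsls M Zd Dd Yd =
       (\<integral>\<omega>. weight M Z X R P (S \<omega>) (X \<omega>) *v mean_effect M S X \<beta> (S \<omega>) (X \<omega>) \<partial>M)"
proof -
  have Y_decomp: "Y \<omega> = \<alpha> (potential_outcomes n Yp \<omega>)
      + (\<Sum>k\<in>UNIV. indicators R (T \<omega>) $ k * effects Yp hi lo \<omega> $ k)" if "\<omega> \<in> space M" for \<omega>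
    using assms(23)[OF that] unfolding D_def \<beta>_def .
  interpret controlled_response M \<Z> n Z X S T Yp Y R hi lo \<alpha>
    by (rule controlled_response.intro, rule assms(8), rule controlled_response_axioms.intro)
      (assumption | rule assms(10-15,17-20,22,24-25) exogeneity_exclusion Y_decomp)+
  define V where "V = matrix_inv (Var M P)"
  have P_eq: "P = proj (Cov M Dd Zd ** matrix_inv (Var M Zd))"
    unfolding P_def lin_proj_def Zd_def ..
  have Zd_nth: "Zd \<omega> $ i = demean M X (\<lambda>\<omega>. Z \<omega> $ i) \<omega>" for \<omega> i
    by (simp add: Zd_def demean_vec_def)
  have "invertible (Var M P)"
    unfolding P_def
  proof (rule invertible_Var_lin_proj)
    show "(\<lambda>\<omega>. Zd \<omega> $ i) \<in> borel_measurable M" for i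
      unfolding Zd_nth by (intro demean_borel Z_nth_borel)
    show "integrable M (\<lambda>\<omega>. (Zd \<omega> $ i)\<^sup>2)" for i
      unfolding Zd_nth by (rule demean_sq)
    show "rank (Cov M Zd Dd) = CARD('n)" using rank_condition by (simp add: n_def)
  qed (rule assms(26))
  \<comment> \<open>Every weight has the same left factor \<open>V\<close>, so linearity will pull
    it out of the expectation and reduce the claim to
    \<open>Cov_scalar_proj_outcome\<close>.\<close>
  have weight_eq: "weight M Z X R P (S \<omega>) (X \<omega>) *v mean_effect M S X \<beta> (S \<omega>) (X \<omega>)
      = V *v weighted_effect (Cov M Dd Zd ** matrix_inv (Var M Zd)) \<omega>" for \<omega>
    unfolding weight_def V_def P_eq \<beta>_def matrix_vector_mul_assoc ..
  have lin: "bounded_linear ((*v) V)" by (rule matrix_vector_mul_bounded_linear)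
  note int = integrable_vecI[OF weighted_effect_int]
  have "tsls M Zd Dd Yd = V *v Cov_scalar M P Yd"
    unfolding tsls_def V_def P_def ..
  also have "\<dots> = V *v (\<integral>\<omega>. weighted_effect (Cov M Dd Zd ** matrix_inv (Var M Zd)) \<omega> \<partial>M)"
    unfolding P_eq Yd_def Cov_scalar_proj_outcome ..
  also have "\<dots> = (\<integral>\<omega>. V *v weighted_effect (Cov M Dd Zd ** matrix_inv (Var M Zd)) \<omega> \<partial>M)"
    by (rule integral_bounded_linear[OF lin int, symmetric])
  finally show ?thesis
    unfolding weight_eq using \<open>invertible (Var M P)\<close> integrable_bounded_linear[OF lin int] by blast
qed

end
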